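(* Let $n\ge1$, let $B_R\subset\mathbb{R}^n$ be the ball centered at $0$ with radius $R$, and let $V$ and $W$ be positive radial $C^1$-functions on $B_R\setminus\{0\}$. Assume $$\int_0^R\frac{1}{\tau^{n-1}V(\tau)}\,d\tau=+\infty\quad\text{and}\quad\int_0^R r^{n-1}V(r)\,dr<\infty .$$ (i) If $$\limsup_{r\to0}\ r^{2(n-1)}V(r)W(r)\Big(\int_r^R\frac{1}{\tau^{n-1}V(\tau)}\,d\tau\Big)^2<\frac14,$$ then for some $\rho>0$ the equation $(\mathrm{B}_{V,W})$ has a positive solution on $(0,\rho)$, and consequently $$\int_{B_\rho}V(x)|\nabla u|^2dx\ge\int_{B_\rho}W(x)u^2dx\quad\text{for all }u\in C_0^\infty(B_\rho),$$ where $B_\rho$ is the ball of radius $\rho$ centered at $0$. (ii) If $$\liminf_{r\to0}\ r^{2(n-1)}V(r)W(r)\Big(\int_r^R\frac{1}{\tau^{n-1}V(\tau)}\,d\tau\Big)^2>\frac14,$$ then there is no interval $(0,\rho)$ on which $(\mathrm{B}_{V,W})$ has a positive solution, and consequently there is no smooth domain $\Omega\subset B_R$ containing $0$ such that $\int_\Omega V(x)|\nabla u|^2dx\ge\int_\Omega W(x)u^2dx$ holds for all $u\in C_0^\infty(\Omega)$.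
   Context: Radial functions are identified with functions of $r=|x|$. $(\mathrm{B}_{V,W})$ denotes the ordinary differential equation $$y''(r)+\Big(\frac{n-1}{r}+\frac{V_r(r)}{V(r)}\Big)y'(r)+\frac{W(r)}{V(r)}y(r)=0,$$ where $V_r$ is the derivative in $r$.
   Formalization: Part (ii) additionally assumes that the integral of 1/(τ^{n-1}V) from r to R is finite for every 0<r<R; otherwise the expression in the liminf is infinite and the claim fails, e.g. n=1, V=R−r, W constant. *)

theory Defs
  imports "HOL-Analysis.Analysis"
begin

(* Only meant for open S, where the derivative at an interior point is the
   unrestricted Frechet derivative. *)
primrec Ck_on :: "nat \<Rightarrow> ('a::euclidean_space \<Rightarrow> real) \<Rightarrow> 'a set \<Rightarrow> bool" where
  "Ck_on 0 f S \<longleftrightarrow> continuous_on S f"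
| "Ck_on (Suc k) f S \<longleftrightarrow>
     (\<forall>x\<in>S. f differentiable (at x)) \<and>
     (\<forall>v. Ck_on k (\<lambda>x. frechet_derivative f (at x) v) S)"

definition smooth_on :: "('a::euclidean_space \<Rightarrow> real) \<Rightarrow> 'a set \<Rightarrow> bool" where
  "smooth_on f S \<longleftrightarrow> (\<forall>k. Ck_on k f S)"

definition gradient :: "('a::euclidean_space \<Rightarrow> real) \<Rightarrow> 'a \<Rightarrow> 'a" where
  "gradient f x = (\<Sum>b\<in>Basis. frechet_derivative f (at x) b *\<^sub>R b)"

definition test_functions :: "'a::euclidean_space set \<Rightarrow> ('a \<Rightarrow> real) set" where
  "test_functions \<Omega> =
     {u. smooth_on u UNIV \<and> compact (closure {x. u x \<noteq> 0}) \<and> closure {x. u x \<noteq> 0} \<subseteq> \<Omega>}"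

(* Smoothness of the boundary is expressed by local defining functions with
   nonvanishing gradient; the domain lies on one side of its boundary. *)
definition smooth_domain :: "'a::euclidean_space set \<Rightarrow> bool" where
  "smooth_domain \<Omega> \<longleftrightarrow>
     open \<Omega> \<and> connected \<Omega> \<and> \<Omega> \<noteq> {} \<and>
     (\<forall>p\<in>frontier \<Omega>. \<exists>U \<phi>. open U \<and> p \<in> U \<and> smooth_on \<phi> U \<and>
        (\<forall>x\<in>U. gradient \<phi> x \<noteq> 0) \<and> \<Omega> \<inter> U = {x\<in>U. \<phi> x < 0})"

(* In the remaining definitions the radial weights V and W are given by their
   profiles, i.e. as functions of r = norm x. *)

definition bessel_solution ::
  "nat \<Rightarrow> (real \<Rightarrow> real) \<Rightarrow> (real \<Rightarrow> real) \<Rightarrow> real \<Rightarrow> (real \<Rightarrow> real) \<Rightarrow> bool" where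
  "bessel_solution n V W \<rho> y \<longleftrightarrow>
     (\<exists>y' y''. \<forall>r\<in>{0<..<\<rho>}.
        (y has_real_derivative y' r) (at r) \<and>
        (y' has_real_derivative y'' r) (at r) \<and>
        y'' r + ((real n - 1) / r + deriv V r / V r) * y' r + W r / V r * y r = 0)"

definition has_positive_solution ::
  "nat \<Rightarrow> (real \<Rightarrow> real) \<Rightarrow> (real \<Rightarrow> real) \<Rightarrow> real \<Rightarrow> bool" where
  "has_positive_solution n V W \<rho> \<longleftrightarrow>
     (\<exists>y. bessel_solution n V W \<rho> y \<and> (\<forall>r\<in>{0<..<\<rho>}. y r > 0))"

(* The integrals are taken in [0, \<infinity>]; both integrands are nonnegative except
   possibly at the origin, where V and W are unspecified. *)
definition hardy_inequality ::
  "(real \<Rightarrow> real) \<Rightarrow> (real \<Rightarrow> real) \<Rightarrow> 'a::euclidean_space set \<Rightarrow> bool" where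
  "hardy_inequality V W \<Omega> \<longleftrightarrow>
     (\<forall>u\<in>test_functions \<Omega>.
        (\<integral>\<^sup>+x\<in>\<Omega>. ennreal (V (norm x) * (norm (gradient u x))\<^sup>2) \<partial>lborel)
          \<ge> (\<integral>\<^sup>+x\<in>\<Omega>. ennreal (W (norm x) * (u x)\<^sup>2) \<partial>lborel))"

definition tail_integral :: "nat \<Rightarrow> (real \<Rightarrow> real) \<Rightarrow> real \<Rightarrow> real \<Rightarrow> ennreal" where
  "tail_integral n V R r = (\<integral>\<^sup>+\<tau>\<in>{r<..<R}. ennreal (1 / (\<tau> ^ (n - 1) * V \<tau>)) \<partial>lborel)"

(* Valued in [0, \<infinity>], so a divergent tail integral makes it \<infinity>; a statement about
   a liminf of it must assume the tail integrals finite for r > 0 if it is to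
   capture the behaviour at the origin rather than a singularity at R. *)
definition kneser_quantity ::
  "nat \<Rightarrow> (real \<Rightarrow> real) \<Rightarrow> (real \<Rightarrow> real) \<Rightarrow> real \<Rightarrow> real \<Rightarrow> ennreal" where
  "kneser_quantity n V W R r =
     ennreal (r ^ (2 * (n - 1)) * V r * W r) * (tail_integral n V R r)\<^sup>2"

end

theory Submission
  imports Defs
begin

text \<open>Put \<open>p = r\<^sup>n\<^sup>-\<^sup>1 V\<close>, \<open>q = r\<^sup>n\<^sup>-\<^sup>1 W\<close> and let \<open>s\<close> be the tail integral of \<open>1/p\<close>, so that the equation reads
  \<open>(p y')' + q y = 0\<close> and the Kneser quantity is \<open>p q s\<^sup>2\<close>. Via \<open>w = - p y'/y\<close>, positive solutions
  correspond to solutions of the Riccati equation \<open>w' = w\<^sup>2/p + q\<close>. If \<open>p q s\<^sup>2 \<le> 1/4\<close>, a nonnegative one is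
  obtained below the supersolution \<open>1/(2s)\<close>, and completing the square in
  \<open>V |\<nabla>u|\<^sup>2 - W u\<^sup>2 + div (w u\<^sup>2 x / r\<^sup>n)\<close> gives the Hardy inequality. If \<open>p q s\<^sup>2 \<ge> c > 1/4\<close>, the functions
  \<open>\<surd>s \<psi>(ln s)\<close> with a stretched bump \<open>\<psi>\<close> have negative energy \<open>\<integral> p \<phi>'\<^sup>2 - q \<phi>\<^sup>2\<close> arbitrarily close
  to the origin; this excludes positive solutions and, after smoothing, every Hardy inequality.\<close>

section \<open>The Riccati equation\<close>

text \<open>The constant 1/4 appears on trying w = k/s with k constant: since s' = -1/p, this is a
  supersolution exactly when p q s^2 \<le> k - k^2, and k - k^2 has its maximum 1/4 at k = 1/2. In
  the opposite direction 1/4 is the square of the exponent in sqrt s.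

  The obstacle is the origin, where 1/p is not integrable and no initial value can be prescribed.
  Hence the equation is solved in integrated form among functions with values in [0, \<infinity>]:
  existence is then a matter of order alone, and finiteness is inherited from the supersolution,
  which tends to 0 at the origin because s diverges there.

  A test function need not vanish near the origin, so the divergence argument needs a cut-off, and
  the derivative of the cut-off contributes a term multiplied by w. This is why the sign of w
  matters for the Hardy inequality. A solution w coming from an arbitrary positive y has no known
  sign; it is only paired with functions supported away from the origin, where boundary terms vanish
  anyway.

  The bumps built from s are only C^1, while Hardy inequalities are tested with smooth functions;
  this forces the polynomial approximation.\<close>

lemma nn_integral_Ioo_split_Icc:
  fixes f :: "real \<Rightarrow> ennreal"
  assumes "c < a" "a \<le> b" and m: "(\<lambda>x. f x * indicator {c<..<b} x) \<in> borel_measurable borel"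
  shows "(\<integral>\<^sup>+x\<in>{c<..<b}. f x \<partial>lborel) = (\<integral>\<^sup>+x\<in>{c<..<a}. f x \<partial>lborel) + (\<integral>\<^sup>+x\<in>{a..b}. f x \<partial>lborel)"
proof -
  let ?g = "\<lambda>x. f x * indicator {c<..<b} x"
  have m': "?g \<in> borel_measurable lborel" using m by simp
  have "(\<integral>\<^sup>+x. ?g x \<partial>lborel) = (\<integral>\<^sup>+x. ?g x * indicator {c<..<a} x + ?g x * indicator {a..b} x \<partial>lborel)"
    using assms by (intro nn_integral_cong) (auto split: split_indicator)
  also have "\<dots> = (\<integral>\<^sup>+x. ?g x * indicator {c<..<a} x \<partial>lborel) + (\<integral>\<^sup>+x. ?g x * indicator {a..b} x \<partial>lborel)"
    using m' by (intro nn_integral_add) auto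
  also have "(\<integral>\<^sup>+x. ?g x * indicator {c<..<a} x \<partial>lborel) = (\<integral>\<^sup>+x\<in>{c<..<a}. f x \<partial>lborel)"
    using assms by (intro nn_integral_cong) (auto split: split_indicator)
  also have "(\<integral>\<^sup>+x. ?g x * indicator {a..b} x \<partial>lborel) = (\<integral>\<^sup>+x\<in>{a..b}. f x \<partial>lborel)"
    using assms by (intro nn_integral_cong_AE eventually_mono[OF AE_lborel_singleton[of b]])
      (auto split: split_indicator)
  finally show ?thesis .
qed

text \<open>The least fixed point of the monotone operator
  \<open>w \<mapsto> (\<lambda>r. \<integral>\<^sub>0\<^sup>r w\<^sup>2/p + q)\<close> lies below the supersolution \<open>1/(2s)\<close>.\<close>

lemma riccati_solution_exists:
  fixes p q s :: "real \<Rightarrow> real"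
  assumes rho: "\<rho> > 0"
    and pc: "continuous_on {0<..<\<rho>} p" and qc: "continuous_on {0<..<\<rho>} q"
    and p: "\<And>r. r \<in> {0<..<\<rho>} \<Longrightarrow> p r > 0" and q: "\<And>r. r \<in> {0<..<\<rho>} \<Longrightarrow> q r > 0"
    and s: "\<And>r. r \<in> {0<..<\<rho>} \<Longrightarrow> s r > 0"
    and ds: "\<And>r. r \<in> {0<..<\<rho>} \<Longrightarrow> (s has_real_derivative - 1 / p r) (at r)"
    and slim: "filterlim s at_top (at_right 0)"
    and bound: "\<And>r. r \<in> {0<..<\<rho>} \<Longrightarrow> p r * q r * (s r)\<^sup>2 \<le> 1/4"
  obtains w where "\<And>r. r \<in> {0<..<\<rho>} \<Longrightarrow> w r \<ge> 0"
    and "\<And>r. r \<in> {0<..<\<rho>} \<Longrightarrow> (w has_real_derivative (w r)\<^sup>2 / p r + q r) (at r)"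
proof -
  define F :: "(real \<Rightarrow> ennreal) \<Rightarrow> real \<Rightarrow> ennreal" where
    "F = (\<lambda>w r. \<integral>\<^sup>+\<tau>\<in>{0<..<r}. ((w \<tau>)\<^sup>2 * ennreal (1 / p \<tau>) + ennreal (q \<tau>)) \<partial>lborel)"
  \<comment> \<open>\<open>nn_integral\<close> is monotone on all functions, measurable or not, so
    the lattice fixed point theorem asks for no regularity. Regularity of \<open>z\<close> is
    recovered afterwards.\<close>
  define z where "z = lfp F"
  have F_mono: "mono F"
    unfolding F_def by (intro monoI le_funI nn_integral_mono mult_right_mono add_right_mono power_mono) 
      (auto simp: le_fun_def)
  have z_eq: "z = F z" unfolding z_def by (rule lfp_unfold[OF F_mono])
  have s_cont: "continuous_on {0<..<\<rho>} s"
    using ds by (meson DERIV_isCont continuous_at_imp_continuous_on)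
  \<comment> \<open>The integrand is the derivative of 1/(2s); the boundary term at 0 vanishes
    because s diverges there.\<close>
  have int_s: "(\<integral>\<^sup>+\<tau>\<in>{0<..<r}. ennreal (1 / (2 * (s \<tau>)\<^sup>2 * p \<tau>)) \<partial>lborel) = ennreal (1 / (2 * s r))"
    if r: "r \<in> {0<..<\<rho>}" for r
  proof -
    let ?f = "\<lambda>\<tau>. 1 / (2 * (s \<tau>)\<^sup>2 * p \<tau>)"
    have ein: "einterval (ereal 0) (ereal r) = {0<..<r}" by simp
    have c: "isCont ?f x" if "0 < x" "x < r" for x
    proof -
      have "x \<in> {0<..<\<rho>}" using that r by auto
      moreover have "continuous_on {0<..<\<rho>} ?f"
        using p s by (intro continuous_intros pc s_cont) force
      ultimately show ?thesis by (simp add: continuous_on_eq_continuous_at)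
    qed
    have d: "((\<lambda>x. 1 / (2 * s x)) has_real_derivative ?f x) (at x)" if "0 < x" "x < r" for x
    proof -
      have x: "x \<in> {0<..<\<rho>}" using that r by auto
      show ?thesis
        using s[OF x] p[OF x] by (auto intro!: derivative_eq_intros ds[OF x] simp: power2_eq_square field_simps)
    qed
    have A: "((\<lambda>x. 1 / (2 * s x)) \<longlongrightarrow> 0) (at_right 0)"
    proof -
      have "((\<lambda>x. (1/2) * inverse (s x)) \<longlongrightarrow> (1/2) * 0) (at_right 0)"
        by (intro tendsto_intros tendsto_inverse_0_at_top slim)
      then show ?thesis by (simp add: field_simps)
    qed
    have "isCont (\<lambda>x. 1 / (2 * s x)) r"
      using ds[OF r] s[OF r] by (intro continuous_intros) (auto intro: DERIV_isCont)
    then have B: "((\<lambda>x. 1 / (2 * s x)) \<longlongrightarrow> 1 / (2 * s r)) (at_left r)"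
      by (simp add: isCont_def filterlim_at_split)
    have nn: "0 \<le> ?f x" if "0 < x" "x < r" for x
      using p[of x] s[of x] that r by auto
    have I: "set_integrable lborel (einterval (ereal 0) (ereal r)) ?f"
      "(LBINT x=ereal 0..ereal r. ?f x) = 1 / (2 * s r) - 0"
      by (rule interval_integral_FTC_nonneg[where F = "\<lambda>x. 1 / (2 * s x)"];
          use r c d A B nn in \<open>auto simp: ereal_tendsto_simps\<close>)+
    have "(\<integral>\<^sup>+\<tau>\<in>{0<..<r}. ennreal (?f \<tau>) \<partial>lborel) = (\<integral>\<^sup>+\<tau>. ennreal (indicator {0<..<r} \<tau> *\<^sub>R ?f \<tau>) \<partial>lborel)"
      by (intro nn_integral_cong) (auto split: split_indicator)
    also have "\<dots> = ennreal (\<integral>\<tau>. indicator {0<..<r} \<tau> *\<^sub>R ?f \<tau> \<partial>lborel)"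
      using I(1) nn unfolding set_integrable_def ein
      by (intro nn_integral_eq_integral) (auto split: split_indicator)
    also have "(\<integral>\<tau>. indicator {0<..<r} \<tau> *\<^sub>R ?f \<tau> \<partial>lborel) = 1 / (2 * s r)"
      using I(2) r unfolding interval_lebesgue_integral_def set_lebesgue_integral_def ein by auto
    finally show ?thesis .
  qed
  \<comment> \<open>\<open>lfp_lowerbound\<close> needs \<open>F B \<le> B\<close> at every real
    number. The value \<open>top\<close> makes this trivial off the interval, and for r inside it
    only values of \<open>B\<close> on (0, r) enter.\<close>
  define B where "B r = (if r \<in> {0<..<\<rho>} then ennreal (1 / (2 * s r)) else top)" for r
  have FB: "F B r \<le> B r" for r
  proof (cases "r \<in> {0<..<\<rho>}")
    case True
    have "F B r \<le> (\<integral>\<^sup>+\<tau>\<in>{0<..<r}. ennreal (1 / (2 * (s \<tau>)\<^sup>2 * p \<tau>)) \<partial>lborel)"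
      unfolding F_def
    proof (intro nn_integral_mono, goal_cases)
      case (1 \<tau>)
      show ?case
      proof (cases "\<tau> \<in> {0<..<r}")
        case t: True
        then have t': "\<tau> \<in> {0<..<\<rho>}" using True by auto
        \<comment> \<open>The derivative 1/(2 s^2 p) of 1/(2s) is split into equal halves: one is
          exactly w^2/p for w = 1/(2s), the other dominates q by the hypothesis.\<close>
        have "q \<tau> \<le> 1 / (4 * (s \<tau>)\<^sup>2 * p \<tau>)"
          using bound[OF t'] p[OF t'] s[OF t'] by (simp add: field_simps)
        moreover have "(1 / (2 * s \<tau>))\<^sup>2 * (1 / p \<tau>) = 1 / (4 * (s \<tau>)\<^sup>2 * p \<tau>)"
          by (simp add: power2_eq_square)
        moreover have "1 / (2 * (s \<tau>)\<^sup>2 * p \<tau>) = 2 * (1 / (4 * (s \<tau>)\<^sup>2 * p \<tau>))" by simp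
        ultimately have "(1 / (2 * s \<tau>))\<^sup>2 * (1 / p \<tau>) + q \<tau> \<le> 1 / (2 * (s \<tau>)\<^sup>2 * p \<tau>)"
          by linarith
        then have "ennreal ((1 / (2 * s \<tau>))\<^sup>2 * (1 / p \<tau>) + q \<tau>) \<le> ennreal (1 / (2 * (s \<tau>)\<^sup>2 * p \<tau>))"
          by (rule ennreal_leI)
        moreover have "ennreal ((1 / (2 * s \<tau>))\<^sup>2 * (1 / p \<tau>) + q \<tau>) = (B \<tau>)\<^sup>2 * ennreal (1 / p \<tau>) + ennreal (q \<tau>)"
          using p[OF t'] s[OF t'] q[OF t'] t'
          by (simp add: B_def ennreal_power ennreal_mult' ennreal_plus flip: ennreal_mult)
        ultimately show ?thesis by (intro mult_right_mono) auto
      qed auto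
    qed
    also have "\<dots> = B r" using int_s[OF True] True by (simp add: B_def)
    finally show ?thesis .
  qed (auto simp: B_def)
  have zB: "z r \<le> B r" for r
    using lfp_lowerbound[of F B] FB unfolding z_def by (auto simp: le_fun_def)
  define w where "w r = enn2real (z r)" for r
  have zw: "z r = ennreal (w r)" if "r \<in> {0<..<\<rho>}" for r
  proof -
    have "z r < top" using zB[of r] that by (auto simp: B_def intro: le_less_trans)
    then show ?thesis by (simp add: w_def)
  qed
  have w0: "w r \<ge> 0" for r by (simp add: w_def)
  define g where "g r = (w r)\<^sup>2 / p r + q r" for r
  have zF: "z r = (\<integral>\<^sup>+\<tau>\<in>{0<..<r}. ennreal (g \<tau>) \<partial>lborel)" if "r \<in> {0<..<\<rho>}" for r
  proof -
    have "z r = F z r" using z_eq by simp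
    also have "\<dots> = (\<integral>\<^sup>+\<tau>\<in>{0<..<r}. ennreal (g \<tau>) \<partial>lborel)"
      unfolding F_def
    proof (intro nn_integral_cong, goal_cases)
      case (1 \<tau>)
      show ?case
      proof (cases "\<tau> \<in> {0<..<r}")
        case True
        then have t': "\<tau> \<in> {0<..<\<rho>}" using that by auto
        show ?thesis using p[OF t'] q[OF t'] w0[of \<tau>]
          by (simp add: zw[OF t'] g_def ennreal_power ennreal_plus divide_inverse flip: ennreal_mult)
      qed auto
    qed
    finally show ?thesis .
  qed
  \<comment> \<open>The fixed point comes without measurability. Monotonicity supplies it; the
    integral form then gives continuity, and continuity of the integrand gives the
    derivative.\<close>
  have w_mono: "mono_on {0<..<\<rho>} w"
  proof (rule mono_onI)
    fix a b assume ab: "a \<in> {0<..<\<rho>}" "b \<in> {0<..<\<rho>}" "a \<le> b"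
    have "z a \<le> z b" unfolding zF[OF ab(1)] zF[OF ab(2)]
      using ab by (intro nn_integral_mono) (auto split: split_indicator)
    then show "w a \<le> w b" using zw[OF ab(1)] zw[OF ab(2)] w0 by (simp add: ennreal_le_iff)
  qed
  have w_meas: "(\<lambda>x. indicator {0<..<\<rho>} x *\<^sub>R w x) \<in> borel_measurable borel"
    using borel_measurable_mono_on_fnc[OF w_mono] by (simp add: borel_measurable_restrict_space_iff)
  have g_meas: "(\<lambda>x. indicator {0<..<\<rho>} x *\<^sub>R g x) \<in> borel_measurable borel"
  proof -
    have [measurable]: "(\<lambda>x. indicator {0<..<\<rho>} x *\<^sub>R p x) \<in> borel_measurable borel"
      "(\<lambda>x. indicator {0<..<\<rho>} x *\<^sub>R q x) \<in> borel_measurable borel"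
      by (auto intro!: borel_measurable_continuous_on_indicator pc qc simp del: real_scaleR_def)
    note w_meas[measurable]
    have "(\<lambda>x. (indicator {0<..<\<rho>} x *\<^sub>R w x)\<^sup>2 / (indicator {0<..<\<rho>} x *\<^sub>R p x) + indicator {0<..<\<rho>} x *\<^sub>R q x)
      \<in> borel_measurable borel" by measurable
    also have "(\<lambda>x. (indicator {0<..<\<rho>} x *\<^sub>R w x)\<^sup>2 / (indicator {0<..<\<rho>} x *\<^sub>R p x) + indicator {0<..<\<rho>} x *\<^sub>R q x)
      = (\<lambda>x. indicator {0<..<\<rho>} x *\<^sub>R g x)" by (auto simp: g_def fun_eq_iff split: split_indicator)
    finally show ?thesis .
  qed
  have g0: "g x \<ge> 0" if "x \<in> {0<..<\<rho>}" for x
    using p[OF that] q[OF that] w0[of x] by (auto simp: g_def)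
  have key: "set_integrable lborel {a..b} g \<and> w b = w a + integral {a..b} g"
    if ab: "0 < a" "a \<le> b" "b < \<rho>" for a b
  proof -
    have A: "a \<in> {0<..<\<rho>}" "b \<in> {0<..<\<rho>}" using ab by auto
    have m: "(\<lambda>x. ennreal (g x) * indicator {0<..<b} x) \<in> borel_measurable borel"
    proof -
      have "(\<lambda>x. ennreal (indicator {0<..<\<rho>} x *\<^sub>R g x) * indicator {0<..<b} x) \<in> borel_measurable borel"
        using g_meas by measurable
      also have "(\<lambda>x. ennreal (indicator {0<..<\<rho>} x *\<^sub>R g x) * indicator {0<..<b} x) = (\<lambda>x. ennreal (g x) * indicator {0<..<b} x)"
        using ab by (auto simp: fun_eq_iff split: split_indicator)
      finally show ?thesis .
    qed
    have e: "(\<integral>\<^sup>+x\<in>{a..b}. ennreal (g x) \<partial>lborel) = (\<integral>\<^sup>+x. ennreal (indicator {a..b} x *\<^sub>R g x) \<partial>lborel)"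
      by (intro nn_integral_cong) (auto split: split_indicator)
    have split: "z b = z a + (\<integral>\<^sup>+x. ennreal (indicator {a..b} x *\<^sub>R g x) \<partial>lborel)"
      unfolding zF[OF A(1)] zF[OF A(2)] e[symmetric]
      using ab by (intro nn_integral_Ioo_split_Icc m) auto
    have "(\<integral>\<^sup>+x. ennreal (indicator {a..b} x *\<^sub>R g x) \<partial>lborel) \<le> z b"
      unfolding split by simp
    also have "\<dots> < \<infinity>" using zw[OF A(2)] by simp
    finally have f: "(\<integral>\<^sup>+x. ennreal (indicator {a..b} x *\<^sub>R g x) \<partial>lborel) < \<infinity>" .
    have m2: "(\<lambda>x. indicator {a..b} x *\<^sub>R g x) \<in> borel_measurable lborel"
    proof -
      have "(\<lambda>x. indicator {a..b} x *\<^sub>R (indicator {0<..<\<rho>} x *\<^sub>R g x)) \<in> borel_measurable borel"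
        using g_meas by measurable
      also have "(\<lambda>x. indicator {a..b} x *\<^sub>R (indicator {0<..<\<rho>} x *\<^sub>R g x)) = (\<lambda>x. indicator {a..b} x *\<^sub>R g x)"
        using ab by (auto simp: fun_eq_iff split: split_indicator)
      finally show ?thesis by simp
    qed
    have nn: "0 \<le> indicator {a..b} x *\<^sub>R g x" for x using g0[of x] ab by (auto split: split_indicator)
    have i: "set_integrable lborel {a..b} g"
      unfolding set_integrable_def by (rule integrableI_nonneg[OF m2 _ f]) (use nn in auto)
    have "(\<integral>\<^sup>+x. ennreal (indicator {a..b} x *\<^sub>R g x) \<partial>lborel) = ennreal (integral {a..b} g)"
      using nn i set_borel_integral_eq_integral(2)[OF i] unfolding set_lebesgue_integral_def set_integrable_def
      by (subst nn_integral_eq_integral) auto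
    moreover have "0 \<le> integral {a..b} g"
      using g0 ab by (intro integral_nonneg set_borel_integral_eq_integral(1) i) auto
    ultimately have "ennreal (w b) = ennreal (w a + integral {a..b} g)"
      using split w0[of a] by (simp add: zw[OF A(1)] zw[OF A(2)])
    then show ?thesis using i w0[of a] w0[of b] \<open>0 \<le> integral {a..b} g\<close>
      by (simp flip: ennreal_plus)
  qed
  have w_ivl: "continuous_on {a..b} w" if "0 < a" "b < \<rho>" for a b
  proof -
    have "continuous_on {a..b} (\<lambda>x. w a + integral {a..x} g)"
    proof (cases "a \<le> b")
      case True
      then show ?thesis using key[of a b] that
        by (intro continuous_intros indefinite_integral_continuous_1 set_borel_integral_eq_integral(1)) auto
    qed auto
    then show ?thesis
      by (rule continuous_on_eq) (use that in \<open>auto intro!: key[THEN conjunct2, symmetric]\<close>)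
  qed
  have dw: "(w has_real_derivative g r) (at r)" if r: "r \<in> {0<..<\<rho>}" for r
  proof -
    define a b where "a = r / 2" and "b = (r + \<rho>) / 2"
    have ab: "0 < a" "a < r" "r < b" "b < \<rho>" using r by (auto simp: a_def b_def)
    have sub: "{a..b} \<subseteq> {0<..<\<rho>}" using ab by auto
    have pne: "\<forall>x\<in>{a..b}. p x \<noteq> 0" using sub p by (metis less_irrefl subsetD)
    have "continuous_on {a..b} g" unfolding g_def
      by (intro continuous_intros w_ivl ab continuous_on_subset[OF pc] continuous_on_subset[OF qc] sub pne)
    then have "((\<lambda>x. integral {a..x} g) has_real_derivative g r) (at r within {a..b})"
      by (rule integral_has_real_derivative) (use ab in auto)
    then have "((\<lambda>x. w a + integral {a..x} g) has_real_derivative g r) (at r within {a..b})"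
      by (auto intro!: derivative_eq_intros)
    then have "(w has_real_derivative g r) (at r within {a..b})"
      by (rule has_field_derivative_transform_within[OF _ zero_less_one])
        (use ab in \<open>auto intro!: key[THEN conjunct2, symmetric]\<close>)
    moreover have "at r within {a..b} = at r"
      using ab by (intro at_within_interior) auto
    ultimately show ?thesis by simp
  qed
  show ?thesis
    by (rule that[of w]) (use w0 dw g_def in auto)
qed

section \<open>Energies in the radial variable\<close>

lemma has_integral_real_derivative:
  fixes f F :: "real \<Rightarrow> real"
  assumes "a \<le> b" "\<And>x. x \<in> {a..b} \<Longrightarrow> (F has_real_derivative f x) (at x)"
  shows "(f has_integral (F b - F a)) {a..b}"
  using assms by (intro fundamental_theorem_of_calculus)
    (auto intro: has_vector_derivative_at_within simp: has_real_derivative_iff_has_vector_derivative)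

text \<open>Squaring removes the corner of \<open>max 0\<close>. Both cut-offs of the development,
  the bump in ln s and the one at the origin, are squares of such truncations and therefore
  C^1.\<close>

lemma has_real_derivative_max_0_power2:
  "((\<lambda>z::real. (max 0 z)\<^sup>2) has_real_derivative 2 * max 0 z) (at z)"
proof -
  consider "z < 0" | "z > 0" | "z = 0" by linarith
  then show ?thesis
  proof cases
    case 1
    have "((\<lambda>z::real. 0) has_real_derivative 0) (at z)" by simp
    then have "((\<lambda>z::real. (max 0 z)\<^sup>2) has_real_derivative 0) (at z)"
      by (rule has_field_derivative_transform_within_open[of _ _ _ "{..<0}"]) (use 1 in auto)
    then show ?thesis using 1 by simp
  next
    case 2
    have "((\<lambda>z::real. z\<^sup>2) has_real_derivative 2 * z) (at z)" by (auto intro!: derivative_eq_intros)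
    then have "((\<lambda>z::real. (max 0 z)\<^sup>2) has_real_derivative 2 * z) (at z)"
      by (rule has_field_derivative_transform_within_open[of _ _ _ "{0<..}"]) (use 2 in auto)
    then show ?thesis using 2 by simp
  next
    case 3
    have "((\<lambda>y::real. (max 0 y)\<^sup>2 / y) \<longlongrightarrow> 0) (at 0)"
    proof (rule Lim_null_comparison)
      show "\<forall>\<^sub>F y in at (0::real). norm ((max 0 y)\<^sup>2 / y) \<le> \<bar>y\<bar>"
        by (rule always_eventually) (auto simp: max_def power2_eq_square)
      show "((\<lambda>y::real. \<bar>y\<bar>) \<longlongrightarrow> 0) (at 0)" by (auto intro!: tendsto_eq_intros)
    qed
    then show ?thesis using 3 by (simp add: has_field_derivative_iff)
  qed
qed

text \<open>In the variable \<open>s\<close> the operator becomes \<open>u\<^sub>s\<^sub>s + p q u\<close>, and with \<open>u = \<surd>s \<psi>(ln s)\<close> the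
  energy becomes \<open>\<integral> \<psi>'\<^sup>2 + (1/4 - p q s\<^sup>2) \<psi>\<^sup>2\<close>; a sufficiently stretched bump \<open>\<psi>\<close> makes it negative.\<close>

lemma negative_energy:
  fixes p q s :: "real \<Rightarrow> real"
  assumes rho: "\<rho> > 0"
    and pc: "continuous_on {0<..<\<rho>} p" and qc: "continuous_on {0<..<\<rho>} q"
    and p: "\<And>r. r \<in> {0<..<\<rho>} \<Longrightarrow> p r > 0"
    and s: "\<And>r. r \<in> {0<..<\<rho>} \<Longrightarrow> s r > 0"
    and ds: "\<And>r. r \<in> {0<..<\<rho>} \<Longrightarrow> (s has_real_derivative - 1 / p r) (at r)"
    and slim: "filterlim s at_top (at_right 0)"
    and c: "c > 1/4"
    and bound: "\<And>r. r \<in> {0<..<\<rho>} \<Longrightarrow> p r * q r * (s r)\<^sup>2 \<ge> c"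
  obtains a b \<phi> \<phi>' where "0 < a" "a < b" "b < \<rho>"
    and "\<And>r. r \<in> {0<..<\<rho>} \<Longrightarrow> (\<phi> has_real_derivative \<phi>' r) (at r)"
    and "continuous_on {0<..<\<rho>} \<phi>'"
    and "\<And>r. r \<in> {0<..<\<rho>} - {a<..<b} \<Longrightarrow> \<phi> r = 0 \<and> \<phi>' r = 0"
    and "integral {a..b} (\<lambda>r. p r * (\<phi>' r)\<^sup>2 - q r * (\<phi> r)\<^sup>2) < 0"
proof -
  \<comment> \<open>Half the width of the bump in the variable ln s. With x = \<open>\<tau>\<close>
    the energy is L times (1/4 - c) 256/315 + 256/(105 L^2), which is negative as soon as L^2 > 3/(c
    - 1/4); the numerator 4 leaves a quarter of the first term.\<close>
  define L where "L = sqrt (4 / (c - 1/4))"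
  have L: "L > 0" "L\<^sup>2 = 4 / (c - 1/4)" using c by (auto simp: L_def)
  \<comment> \<open>The window [T - L, T + L] for ln s starts above the value at \<rho>/2, so the
    bump lives in (0, \<rho>/2); the summand 1 makes this strict.\<close>
  define T where "T = ln (s (\<rho>/2)) + L + 1"
  define \<tau> where "\<tau> r = (ln (s r) - T) / L" for r
  define m where "m r = max 0 (1 - (\<tau> r)\<^sup>2)" for r
  define \<phi> where "\<phi> r = sqrt (s r) * (m r)\<^sup>2" for r
  \<comment> \<open>By the chain rule through s, this is -(1/p) (\<psi>/2 + \<psi>') / sqrt s, where
    \<psi> = \<open>(m r)\<^sup>2\<close> and \<psi>' is its derivative in ln s.\<close>
  define \<phi>' where "\<phi>' r = - (1 / p r) * ((m r)\<^sup>2 / 2 - 4 * \<tau> r * m r / L) / sqrt (s r)" for r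
  have s_cont: "continuous_on {0<..<\<rho>} s"
    using ds by (meson DERIV_isCont continuous_at_imp_continuous_on)
  have s_dec: "s y < s x" if "0 < x" "x < y" "y < \<rho>" for x y
  proof (rule DERIV_neg_imp_decreasing[OF that(2)])
    fix z assume "x \<le> z" "z \<le> y"
    then have "z \<in> {0<..<\<rho>}" using that by auto
    then show "\<exists>l. DERIV s z :> l \<and> l < 0" using ds[of z] p[of z] by (intro exI[of _ "- 1 / p z"]) auto
  qed
  have d\<tau>: "(\<tau> has_real_derivative - 1 / (p r * s r * L)) (at r)" if "r \<in> {0<..<\<rho>}" for r
    unfolding \<tau>_def[abs_def] using p[OF that] s[OF that] L(1)
    by (auto intro!: derivative_eq_intros ds[OF that] simp: field_simps)
  have ends: "\<exists>r\<in>{0<..<\<rho>/2}. s r = exp (T + x * L)" if x: "\<bar>x\<bar> \<le> 1" for x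
  proof -
    have r2: "\<rho>/2 \<in> {0<..<\<rho>}" using rho by auto
    have "\<forall>\<^sub>F r in at_right 0. s r > exp (T + x * L)"
      using slim by (auto simp: filterlim_at_top_dense)
    moreover have "\<forall>\<^sub>F r in at_right 0. r \<in> {0<..<\<rho>/2}"
      using rho by (intro eventually_at_right_real) auto
    ultimately have "\<forall>\<^sub>F r in at_right 0. s r > exp (T + x * L) \<and> r \<in> {0<..<\<rho>/2}"
      by (rule eventually_conj)
    then obtain r0 where r0: "s r0 > exp (T + x * L)" "r0 \<in> {0<..<\<rho>/2}"
      using eventually_happens'[of "at_right (0::real)"] by auto
    have "x * L \<ge> - L" using mult_right_mono[of "-1" x L] x L(1) by (auto simp: abs_le_iff)
    then have "ln (s (\<rho>/2)) < T + x * L" unfolding T_def by simp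
    then have 1: "s (\<rho>/2) < exp (T + x * L)" using s[OF r2] by (metis exp_less_cancel_iff exp_ln)
    have "\<exists>r\<ge>r0. r \<le> \<rho>/2 \<and> s r = exp (T + x * L)"
      by (rule IVT2') (use r0 1 rho in \<open>auto intro!: continuous_on_subset[OF s_cont]\<close>)
    then obtain r where "r \<ge> r0" "r \<le> \<rho>/2" "s r = exp (T + x * L)" by auto
    moreover from this have "r \<noteq> \<rho>/2" using 1 by auto
    ultimately show ?thesis using r0 by (intro bexI[of _ r]) auto
  qed
  obtain a where a: "a \<in> {0<..<\<rho>/2}" "s a = exp (T + L)" using ends[of 1] by auto
  obtain b where b: "b \<in> {0<..<\<rho>/2}" "s b = exp (T - L)" using ends[of "-1"] by auto
  \<comment> \<open>Since s decreases, the left end a has \<tau> = 1 and the right end b has \<tau>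
    = -1. This reversal causes the minus sign in front of \<open>L * M (\<tau> r)\<close>
    below.\<close>
  have \<tau>ab: "\<tau> a = 1" "\<tau> b = -1" using L(1) by (auto simp: \<tau>_def a b)
  have ab: "a < b"
  proof (rule ccontr)
    assume "\<not> a < b"
    then have "b = a \<or> b < a" by auto
    then have "s a \<le> s b" using s_dec[of b a] a b by auto
    then show False using a b L by simp
  qed
  have \<tau>_dec: "\<tau> y < \<tau> x" if "0 < x" "x < y" "y < \<rho>" for x y
    using s_dec[OF that] s[of x] s[of y] that L(1) by (auto simp: \<tau>_def divide_strict_right_mono)
  have m0: "m r = 0" if "r \<in> {0<..<\<rho>} - {a<..<b}" for r
  proof -
    have "\<tau> r \<ge> 1 \<or> \<tau> r \<le> -1"
      using \<tau>_dec[of r a] \<tau>_dec[of b r] that \<tau>ab a b by (cases "r = a \<or> r = b") force+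
    then have "1 \<le> (\<tau> r)\<^sup>2" using abs_le_square_iff[of 1 "\<tau> r"] by auto
    then show ?thesis by (simp add: m_def)
  qed
  have m1: "m r = 1 - (\<tau> r)\<^sup>2" if "r \<in> {a..b}" for r
  proof -
    have "\<tau> r \<le> 1" "\<tau> r \<ge> -1"
      using \<tau>_dec[of a r] \<tau>_dec[of r b] that \<tau>ab a b by (cases "r = a"; cases "r = b"; force)+
    then have "(\<tau> r)\<^sup>2 \<le> 1" by (simp add: abs_square_le_1)
    then show ?thesis by (simp add: m_def)
  qed
  have d\<phi>: "(\<phi> has_real_derivative \<phi>' r) (at r)" if r: "r \<in> {0<..<\<rho>}" for r
  proof -
    have sq: "sqrt (s r) > 0" "sqrt (s r) * sqrt (s r) = s r" using s[OF r] by auto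
    have "((\<lambda>r. 1 - (\<tau> r)\<^sup>2) has_real_derivative 2 * \<tau> r / (p r * s r * L)) (at r)"
      by (auto intro!: derivative_eq_intros d\<tau>[OF r])
    then have 1: "((\<lambda>r. (m r)\<^sup>2) has_real_derivative 2 * m r * (2 * \<tau> r / (p r * s r * L))) (at r)"
      unfolding m_def[abs_def] by (rule DERIV_chain2[OF has_real_derivative_max_0_power2])
    have 2: "((\<lambda>r. sqrt (s r)) has_real_derivative (inverse (sqrt (s r)) / 2) * (- 1 / p r)) (at r)"
      by (rule DERIV_chain2[OF DERIV_real_sqrt[OF s[OF r]] ds[OF r]])
    have 3: "1 / s r = 1 / sqrt (s r) * (1 / sqrt (s r))" using sq by simp
    show ?thesis unfolding \<phi>_def[abs_def]
      apply (rule DERIV_cong[OF DERIV_mult[OF 2 1]])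
      using p[OF r] L(1) s[OF r] sq(1) unfolding \<phi>'_def 3
      by (simp add: divide_simps) (simp add: algebra_simps)
  qed
  have c1: "continuous_on {0<..<\<rho>} \<tau>"
    using d\<tau> by (meson DERIV_isCont continuous_at_imp_continuous_on)
  have c2: "continuous_on {0<..<\<rho>} \<phi>'"
    unfolding \<phi>'_def m_def
    using p s L(1) by (intro continuous_intros pc s_cont c1) force+
  have c3: "continuous_on {0<..<\<rho>} \<phi>"
    using d\<phi> by (meson DERIV_isCont continuous_at_imp_continuous_on)
  define K where "K = 1 / L"
  \<comment> \<open>An explicit antiderivative of (\<psi>/2 + \<psi>')^2 - c \<psi>^2 for \<psi> =
    (1 - x^2)^2. Its middle summand is the antiderivative of the cross term \<psi> \<psi>'; it takes
    the value 0 at both ends x = 1 and x = -1.\<close>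
  define M where "M x = (1/4 - c) * (x - 4/3 * x^3 + 6/5 * x^5 - 4/7 * x^7 + 1/9 * x^9)
      + K / 2 * (1 - x\<^sup>2)^4 + 16 * K\<^sup>2 * (1/3 * x^3 - 2/5 * x^5 + 1/7 * x^7)" for x
  have dM: "(M has_real_derivative ((1 - x\<^sup>2)\<^sup>2 / 2 - 4 * x * (1 - x\<^sup>2) / L)\<^sup>2 - c * (1 - x\<^sup>2)^4) (at x)" for x
  proof -
    have "(M has_real_derivative (1/4 - c) * (1 - 4 * x^2 + 6 * x^4 - 4 * x^6 + x^8)
      + K / 2 * (4 * (1 - x\<^sup>2)^3 * (- (2 * x))) + 16 * K\<^sup>2 * (x^2 - 2 * x^4 + x^6)) (at x)"
      unfolding M_def[abs_def] by (auto intro!: derivative_eq_intros)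
    also have "(1/4 - c) * (1 - 4 * x^2 + 6 * x^4 - 4 * x^6 + x^8)
      + K / 2 * (4 * (1 - x\<^sup>2)^3 * (- (2 * x))) + 16 * K\<^sup>2 * (x^2 - 2 * x^4 + x^6)
      = ((1 - x\<^sup>2)\<^sup>2 / 2 - 4 * x * (1 - x\<^sup>2) * K)\<^sup>2 - c * (1 - x\<^sup>2)^4"
      by (simp add: field_simps eval_nat_numeral)
    finally show ?thesis by (simp add: K_def)
  qed
  \<comment> \<open>The energy density on [a, b] with p q s^2 replaced by its lower bound c, hence a
    majorant of the true one. The denominator p s is the Jacobian of ln s up to sign.\<close>
  define N where "N r = (((1 - (\<tau> r)\<^sup>2)\<^sup>2 / 2 - 4 * \<tau> r * (1 - (\<tau> r)\<^sup>2) / L)\<^sup>2 - c * (1 - (\<tau> r)\<^sup>2)^4) / (p r * s r)" for r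
  have dN: "((\<lambda>r. - L * M (\<tau> r)) has_real_derivative N r) (at r)" if r: "r \<in> {0<..<\<rho>}" for r
    unfolding N_def
    by (rule DERIV_cong[OF DERIV_cmult[OF DERIV_chain2[OF dM d\<tau>[OF r]]]]) (use L(1) in simp)
  have "(N has_integral (- L * M (\<tau> b) - (- L * M (\<tau> a)))) {a..b}"
    by (rule has_integral_real_derivative) (use ab a b dN in auto)
  then have N_int: "(N has_integral (L * (M 1 - M (-1)))) {a..b}"
    by (simp add: \<tau>ab algebra_simps)
  \<comment> \<open>256/315 is the integral of (1 - x^2)^4 over [-1, 1], and 256/105 that of (4 x (1
    - x^2))^2.\<close>
  have "M 1 - M (-1) = (1/4 - c) * (256/315) + 256 / 105 / L\<^sup>2"
    unfolding M_def K_def by (simp add: power_divide)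
  also have "\<dots> = (1/4 - c) * (256/315) * (1/4)" unfolding L(2) using c by (simp add: field_simps)
  also have "\<dots> < 0" using c by simp
  finally have neg: "L * (M 1 - M (-1)) < 0" using L(1) by (simp add: mult_pos_neg)
  have le: "p r * (\<phi>' r)\<^sup>2 - q r * (\<phi> r)\<^sup>2 \<le> N r" if r: "r \<in> {a..b}" for r
  proof -
    have r': "r \<in> {0<..<\<rho>}" using r a b by auto
    define k where "k = (m r)\<^sup>2 / 2 - 4 * \<tau> r * m r / L"
    have e1: "p r * (\<phi>' r)\<^sup>2 = k\<^sup>2 / (p r * s r)"
    proof -
      have "(\<phi>' r)\<^sup>2 = k\<^sup>2 / ((p r)\<^sup>2 * s r)" unfolding \<phi>'_def k_def[symmetric]
        using s[OF r'] by (simp add: power_divide power_mult_distrib)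
      then show ?thesis using p[OF r'] by (simp add: power2_eq_square)
    qed
    have "c / (p r * s r) \<le> q r * s r"
      using bound[OF r'] p[OF r'] s[OF r'] by (simp add: field_simps power2_eq_square)
    then have "c / (p r * s r) * (m r)^4 \<le> q r * s r * (m r)^4" by (rule mult_right_mono) simp
    moreover have "(\<phi> r)\<^sup>2 = s r * (m r)^4"
      unfolding \<phi>_def using s[OF r'] by (simp add: power_mult_distrib)
    ultimately have "q r * (\<phi> r)\<^sup>2 \<ge> c * (m r)^4 / (p r * s r)" by simp
    moreover have "N r = k\<^sup>2 / (p r * s r) - c * (m r)^4 / (p r * s r)"
      unfolding N_def k_def m1[OF r] by (simp add: diff_divide_distrib)
    ultimately show ?thesis using e1 by simp
  qed
  have "integral {a..b} (\<lambda>r. p r * (\<phi>' r)\<^sup>2 - q r * (\<phi> r)\<^sup>2) \<le> L * (M 1 - M (-1))"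
  proof (rule integral_le[OF _ _ le, THEN order_trans])
    have "{a..b} \<subseteq> {0<..<\<rho>}" using a b by auto
    then show "(\<lambda>r. p r * (\<phi>' r)\<^sup>2 - q r * (\<phi> r)\<^sup>2) integrable_on {a..b}"
      by (intro integrable_continuous_real continuous_intros continuous_on_subset[OF pc]
          continuous_on_subset[OF qc] continuous_on_subset[OF c2] continuous_on_subset[OF c3])
    show "N integrable_on {a..b}" using N_int by auto
    show "integral {a..b} N \<le> L * (M 1 - M (-1))" using N_int by (simp add: integral_unique)
  qed
  with neg have "integral {a..b} (\<lambda>r. p r * (\<phi>' r)\<^sup>2 - q r * (\<phi> r)\<^sup>2) < 0" by simp
  then show ?thesis
    using that[of a b \<phi> \<phi>'] a b ab d\<phi> c2 m0 rho by (auto simp: \<phi>_def \<phi>'_def)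
qed

text \<open>Picone's identity: p \<phi>'^2 - q \<phi>^2 + (w \<phi>^2)' = p (\<phi>' + w \<phi> /
  p)^2. The total derivative integrates to 0 because \<phi> vanishes at both ends, whatever the sign
  of w.\<close>

lemma riccati_energy_nonneg:
  fixes p q w \<phi> :: "real \<Rightarrow> real"
  assumes ab: "a < b"
    and pc: "continuous_on {a..b} p" and qc: "continuous_on {a..b} q"
    and p: "\<And>r. r \<in> {a..b} \<Longrightarrow> p r > 0"
    and w: "\<And>r. r \<in> {a..b} \<Longrightarrow> (w has_real_derivative (w r)\<^sup>2 / p r + q r) (at r)"
    and \<phi>: "\<And>r. r \<in> {a..b} \<Longrightarrow> (\<phi> has_real_derivative \<phi>' r) (at r)"
    and \<phi>': "continuous_on {a..b} \<phi>'"
    and zero: "\<phi> a = 0" "\<phi> b = 0"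
  shows "integral {a..b} (\<lambda>r. p r * (\<phi>' r)\<^sup>2 - q r * (\<phi> r)\<^sup>2) \<ge> 0"
proof -
  define g where "g r = - (((w r)\<^sup>2 / p r + q r) * (\<phi> r)\<^sup>2 + w r * (2 * \<phi> r * \<phi>' r))" for r
  have "((\<lambda>r. - (w r * (\<phi> r)\<^sup>2)) has_real_derivative g r) (at r)" if "r \<in> {a..b}" for r
    unfolding g_def by (auto intro!: derivative_eq_intros w[OF that] \<phi>[OF that] simp: power2_eq_square)
  then have "(g has_integral (- (w b * (\<phi> b)\<^sup>2) - (- (w a * (\<phi> a)\<^sup>2)))) {a..b}"
    using ab by (intro has_integral_real_derivative) auto
  then have g: "(g has_integral 0) {a..b}" by (simp add: zero)
  have le: "g r \<le> p r * (\<phi>' r)\<^sup>2 - q r * (\<phi> r)\<^sup>2" if r: "r \<in> {a..b}" for r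
  proof -
    have "0 \<le> p r * (\<phi>' r + w r * \<phi> r / p r)\<^sup>2" using p[OF r] by simp
    also have "\<dots> = p r * (\<phi>' r)\<^sup>2 + (w r)\<^sup>2 / p r * (\<phi> r)\<^sup>2 + 2 * w r * \<phi> r * \<phi>' r"
      using p[OF r] by (simp add: field_simps power2_eq_square)
    finally show ?thesis unfolding g_def by (simp add: algebra_simps)
  qed
  have "continuous_on {a..b} \<phi>"
    using \<phi> by (meson DERIV_isCont continuous_at_imp_continuous_on)
  then have "(\<lambda>r. p r * (\<phi>' r)\<^sup>2 - q r * (\<phi> r)\<^sup>2) integrable_on {a..b}"
    by (intro integrable_continuous_real continuous_intros pc qc \<phi>')
  then have "integral {a..b} g \<le> integral {a..b} (\<lambda>r. p r * (\<phi>' r)\<^sup>2 - q r * (\<phi> r)\<^sup>2)"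
    using g le by (intro integral_le) auto
  then show ?thesis using g by (simp add: integral_unique)
qed

section \<open>The weights and the differential equation\<close>

text \<open>Along the ray spanned by a unit vector e the profile is the radial function itself, so
  its derivative at r is the directional derivative at r e.\<close>

lemma C1_radial_profile:
  fixes V :: "real \<Rightarrow> real"
  assumes "Ck_on 1 (\<lambda>x::'a::euclidean_space. V (norm x)) (ball 0 R - {0})"
  shows "\<And>r. r \<in> {0<..<R} \<Longrightarrow> (V has_real_derivative deriv V r) (at r)"
    and "continuous_on {0<..<R} (deriv V)"
proof -
  obtain e :: 'a where e: "e \<in> Basis" using nonempty_Basis by blast
  let ?f = "\<lambda>x::'a. V (norm x)"
  let ?S = "ball (0::'a) R - {0}"
  have diff: "?f differentiable (at x)" if "x \<in> ?S" for x using assms that by simp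
  have cont: "continuous_on ?S (\<lambda>x. frechet_derivative ?f (at x) e)" using assms by simp
  have d: "(V has_real_derivative frechet_derivative ?f (at (r *\<^sub>R e)) e) (at r)" if r: "r \<in> {0<..<R}" for r
  proof -
    have "r *\<^sub>R e \<in> ?S" using r e by auto
    from diff[OF this] have D: "(?f has_derivative frechet_derivative ?f (at (r *\<^sub>R e))) (at (r *\<^sub>R e))"
      using frechet_derivative_works by blast
    have lin: "frechet_derivative ?f (at (r *\<^sub>R e)) (h *\<^sub>R e) = h * frechet_derivative ?f (at (r *\<^sub>R e)) e" for h
      using linear_cmul[OF has_derivative_linear[OF D]] by simp
    have "((\<lambda>t. t *\<^sub>R e) has_derivative (\<lambda>h. h *\<^sub>R e)) (at r)"
      by (auto intro!: derivative_eq_intros)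
    from has_derivative_compose[OF this D]
    have "((\<lambda>t. V (norm (t *\<^sub>R e))) has_derivative (\<lambda>h. h * frechet_derivative ?f (at (r *\<^sub>R e)) e)) (at r)"
      by (simp add: lin)
    then have "((\<lambda>t. V (norm (t *\<^sub>R e))) has_real_derivative frechet_derivative ?f (at (r *\<^sub>R e)) e) (at r)"
      by (simp add: has_field_derivative_def mult_commute_abs)
    then show ?thesis
      by (rule has_field_derivative_transform_within_open[of _ _ _ "{0<..}"]) (use r e in auto)
  qed
  then have eq: "deriv V r = frechet_derivative ?f (at (r *\<^sub>R e)) e" if "r \<in> {0<..<R}" for r
    using that DERIV_imp_deriv by blast
  show "(V has_real_derivative deriv V r) (at r)" if "r \<in> {0<..<R}" for r
    using d[OF that] eq[OF that] by simp
  have "continuous_on {0<..<R} (\<lambda>r. frechet_derivative ?f (at (r *\<^sub>R e)) e)"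
    by (rule continuous_on_compose2[OF cont]) (use e in \<open>auto intro!: continuous_intros\<close>)
  then show "continuous_on {0<..<R} (deriv V)"
    by (rule continuous_on_eq) (use eq in auto)
qed

text \<open>Splitting off a compact interval shows that the tail is an antiderivative of -g.
  Positivity follows from strict decrease towards a nonnegative value at a larger point, and the
  infinite integral at 0 passes to the limit by monotone convergence.\<close>

lemma nn_integral_tail:
  fixes g :: "real \<Rightarrow> real" and R :: real
  defines "tail \<equiv> \<lambda>r. \<integral>\<^sup>+\<tau>\<in>{r<..<R}. ennreal (g \<tau>) \<partial>lborel"
  defines "s \<equiv> \<lambda>r. enn2real (tail r)"
  assumes R: "R > 0" and gc: "continuous_on {0<..<R} g" and g: "\<And>r. r \<in> {0<..<R} \<Longrightarrow> g r > 0"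
    and fin: "\<And>r. r \<in> {0<..<R} \<Longrightarrow> tail r < \<infinity>" and div: "tail 0 = \<infinity>"
  shows "\<And>r. r \<in> {0<..<R} \<Longrightarrow> tail r = ennreal (s r)"
    and "\<And>r. r \<in> {0<..<R} \<Longrightarrow> s r > 0"
    and "\<And>r. r \<in> {0<..<R} \<Longrightarrow> (s has_real_derivative - g r) (at r)"
    and "filterlim s at_top (at_right 0)"
proof -
  show ts: "tail r = ennreal (s r)" if "r \<in> {0<..<R}" for r
    using fin[OF that] by (simp add: s_def)
  have gm: "(\<lambda>x. ennreal (g x) * indicator {0<..<R} x) \<in> borel_measurable borel"
  proof -
    have "(\<lambda>x. ennreal (indicator {0<..<R} x *\<^sub>R g x)) \<in> borel_measurable borel"
      by (auto intro!: measurable_compose[OF _ measurable_ennreal] borel_measurable_continuous_on_indicator gc simp del: real_scaleR_def)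
    also have "(\<lambda>x. ennreal (indicator {0<..<R} x *\<^sub>R g x)) = (\<lambda>x. ennreal (g x) * indicator {0<..<R} x)"
      by (auto simp: fun_eq_iff split: split_indicator)
    finally show ?thesis .
  qed
  have split: "s a = integral {a..b} g + s b" if ab: "0 < a" "a \<le> b" "b < R" for a b
  proof -
    have "tail a = (\<integral>\<^sup>+x. (ennreal (g x) * indicator {0<..<R} x) * indicator {a..b} x + (ennreal (g x) * indicator {0<..<R} x) * indicator {b<..<R} x \<partial>lborel)"
      unfolding tail_def using ab
      by (intro nn_integral_cong_AE eventually_mono[OF AE_lborel_singleton[of a]]) (auto split: split_indicator)
    also have "\<dots> = (\<integral>\<^sup>+x. (ennreal (g x) * indicator {0<..<R} x) * indicator {a..b} x \<partial>lborel) + (\<integral>\<^sup>+x. (ennreal (g x) * indicator {0<..<R} x) * indicator {b<..<R} x \<partial>lborel)"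
      using gm by (intro nn_integral_add) auto
    also have "(\<integral>\<^sup>+x. (ennreal (g x) * indicator {0<..<R} x) * indicator {b<..<R} x \<partial>lborel) = tail b"
      unfolding tail_def using ab by (intro nn_integral_cong) (auto split: split_indicator)
    also have "(\<integral>\<^sup>+x. (ennreal (g x) * indicator {0<..<R} x) * indicator {a..b} x \<partial>lborel)
      = (\<integral>\<^sup>+x. ennreal (indicator {a..b} x *\<^sub>R g x) \<partial>lborel)"
      using ab by (intro nn_integral_cong) (auto split: split_indicator)
    also have "\<dots> = ennreal (integral {a..b} g)"
    proof -
      have i: "set_integrable lborel {a..b} g"
        using ab by (intro borel_integrable_atLeastAtMost' continuous_on_subset[OF gc]) auto
      have nn: "0 \<le> indicator {a..b} x *\<^sub>R g x" for x using g[of x] ab by (auto split: split_indicator)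
      show ?thesis using nn i set_borel_integral_eq_integral(2)[OF i]
        unfolding set_lebesgue_integral_def set_integrable_def
        by (subst nn_integral_eq_integral) auto
    qed
    finally have "ennreal (s a) = ennreal (integral {a..b} g) + ennreal (s b)"
      using ts[of a] ts[of b] ab by simp
    moreover have "0 \<le> integral {a..b} g"
      using g ab by (intro integral_nonneg integrable_continuous_real continuous_on_subset[OF gc]) (auto simp: less_imp_le)
    moreover have "s a \<ge> 0" "s b \<ge> 0" by (simp_all add: s_def)
    ultimately show ?thesis by (simp flip: ennreal_plus)
  qed
  show ds: "(s has_real_derivative - g r) (at r)" if r: "r \<in> {0<..<R}" for r
  proof -
    define a b where "a = r / 2" and "b = (r + R) / 2"
    have ab: "0 < a" "a < r" "r < b" "b < R" using r by (auto simp: a_def b_def)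
    have "continuous_on {a..b} g" by (rule continuous_on_subset[OF gc]) (use ab in auto)
    then have "((\<lambda>x. integral {x..b} g) has_real_derivative - g r) (at r within {a..b})"
      by (rule integral_has_real_derivative') (use ab in auto)
    then have "((\<lambda>x. integral {x..b} g + s b) has_real_derivative - g r) (at r within {a..b})"
      by (auto intro!: derivative_eq_intros)
    then have "(s has_real_derivative - g r) (at r within {a..b})"
      by (rule has_field_derivative_transform_within[OF _ zero_less_one])
        (use ab in \<open>auto intro!: split[symmetric]\<close>)
    moreover have "at r within {a..b} = at r"
      using ab by (intro at_within_interior) auto
    ultimately show ?thesis by simp
  qed
  show "s r > 0" if r: "r \<in> {0<..<R}" for r
  proof -
    have "s ((r + R)/2) < s r"
    proof (rule DERIV_neg_imp_decreasing[of r "(r + R)/2" s])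
      fix z assume "r \<le> z" "z \<le> (r + R) / 2"
      then have "z \<in> {0<..<R}" using r by auto
      then show "\<exists>l. DERIV s z :> l \<and> l < 0" using ds[of z] g[of z] by (intro exI[of _ "- g z"]) auto
    qed (use r in auto)
    moreover have "s ((r + R)/2) \<ge> 0" by (simp add: s_def)
    ultimately show ?thesis by simp
  qed
  show "filterlim s at_top (at_right 0)"
    unfolding filterlim_at_top_dense
  proof
    fix Z :: real
    \<comment> \<open>The intervals (1/(k+1), R) exhaust (0, R), so some tail starting at a positive
      point already exceeds Z; all tails starting closer to 0 are larger still.\<close>
    let ?h = "\<lambda>(n::nat) x. (ennreal (g x) * indicator {0<..<R} x) * indicator {inverse (real (Suc n))<..<R} x"
    have "tail 0 = (\<integral>\<^sup>+x. (SUP n. ?h n x) \<partial>lborel)"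
      unfolding tail_def
    proof (intro nn_integral_cong antisym SUP_least)
      fix x show "ennreal (g x) * indicator {0<..<R} x \<le> (SUP n. ?h n x)"
      proof (cases "x \<in> {0<..<R}")
        case True
        then obtain n where "inverse (real (Suc n)) < x" using reals_Archimedean by auto
        then show ?thesis using True by (intro SUP_upper2[of n]) auto
      qed auto
    qed (auto split: split_indicator)
    also have "\<dots> = (SUP n. \<integral>\<^sup>+x. ?h n x \<partial>lborel)"
    proof (rule nn_integral_monotone_convergence_SUP)
      have "inverse (real (Suc n)) \<le> inverse (real (Suc m))" if "m \<le> n" for m n
        using that by (simp add: field_simps)
      then have sub: "{inverse (real (Suc m))<..<R} \<subseteq> {inverse (real (Suc n))<..<R}" if "m \<le> n" for m n
        using that by (intro greaterThanLessThan_subseteq_greaterThanLessThan[THEN iffD2]) auto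
      have "(indicator {inverse (real (Suc m))<..<R} x :: ennreal) \<le> indicator {inverse (real (Suc n))<..<R} x"
        if "m \<le> n" for m n x
        using subsetD[OF sub[OF that], of x] by (simp only: indicator_def) (simp del: of_nat_Suc)
      then show "incseq ?h"
        by (intro monoI le_funI mult_left_mono) auto
    qed (use gm in auto)
    also have "(\<lambda>n. \<integral>\<^sup>+x. ?h n x \<partial>lborel) = (\<lambda>n. tail (inverse (real (Suc n))))"
      unfolding tail_def by (intro ext nn_integral_cong) (auto split: split_indicator intro: less_trans[rotated])
    finally have "ennreal (max 0 Z) < (SUP n. tail (inverse (real (Suc n))))" using div by simp
    then obtain n where n: "ennreal (max 0 Z) < tail (inverse (real (Suc n)))" by (auto simp: less_SUP_iff)
    have "\<forall>\<^sub>F r in at_right 0. r \<in> {0<..<min R (inverse (real (Suc n)))}"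
      using R by (intro eventually_at_right_real) auto
    then show "\<forall>\<^sub>F r in at_right 0. Z < s r"
    proof eventually_elim
      case (elim r)
      have "tail (inverse (real (Suc n))) \<le> tail r"
        unfolding tail_def using elim by (intro nn_integral_mono) (auto split: split_indicator)
      with n have "ennreal (max 0 Z) < ennreal (s r)" using ts[of r] elim by auto
      then show ?case by (simp add: ennreal_less_iff)
    qed
  qed
qed

text \<open>The coefficient of y' in the equation is the logarithmic derivative of p = r^(n-1) V,
  which is what brings the equation into divergence form.\<close>

lemma has_real_derivative_weight:
  fixes V :: "real \<Rightarrow> real"
  assumes "r > 0" "V r \<noteq> 0" "(V has_real_derivative V') (at r)" "n \<ge> 1"
  shows "((\<lambda>r. r ^ (n - 1) * V r) has_real_derivative (r ^ (n - 1) * V r) * ((real n - 1) / r + V' / V r)) (at r)"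
proof -
  have e: "real (n - 1) * r ^ (n - 1 - Suc 0) = (real n - 1) * (r ^ (n - 1) / r)"
    using assms by (cases "n - 1") auto
  have "((\<lambda>r. r ^ (n - 1)) has_real_derivative (real n - 1) * (r ^ (n - 1) / r)) (at r)"
    using DERIV_pow[of "n - 1" r UNIV] unfolding e .
  from DERIV_mult[OF this assms(3)] show ?thesis
    by (rule DERIV_cong) (use assms in \<open>simp add: field_simps\<close>)
qed

text \<open>Undoing the substitution gives y' / y = - w / p. Taking y as the exponential of an
  antiderivative makes it positive automatically.\<close>

lemma riccati_imp_positive_solution:
  fixes V W w :: "real \<Rightarrow> real"
  assumes rho: "\<rho> > 0" and n: "n \<ge> 1" and V: "\<And>r. r \<in> {0<..<\<rho>} \<Longrightarrow> V r > 0"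
    and dV: "\<And>r. r \<in> {0<..<\<rho>} \<Longrightarrow> (V has_real_derivative deriv V r) (at r)"
    and w: "\<And>r. r \<in> {0<..<\<rho>} \<Longrightarrow>
      (w has_real_derivative (w r)\<^sup>2 / (r ^ (n - 1) * V r) + r ^ (n - 1) * W r) (at r)"
  shows "has_positive_solution n V W \<rho>"
proof -
  define p where "p r = r ^ (n - 1) * V r" for r
  have p: "p r > 0" if "r \<in> {0<..<\<rho>}" for r using V[OF that] that by (simp add: p_def)
  have dp: "(p has_real_derivative p r * ((real n - 1) / r + deriv V r / V r)) (at r)" if "r \<in> {0<..<\<rho>}" for r
    unfolding p_def[abs_def] using that V[OF that] dV[OF that] n by (intro has_real_derivative_weight) auto
  have "\<exists>Y. \<forall>x. ereal 0 < ereal x \<longrightarrow> ereal x < ereal \<rho> \<longrightarrow> (Y has_vector_derivative - w x / p x) (at x)"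
  proof (rule einterval_antiderivative)
    fix x assume "ereal 0 < ereal x" "ereal x < ereal \<rho>"
    then have x: "x \<in> {0<..<\<rho>}" by auto
    show "isCont (\<lambda>x. - w x / p x) x"
      using p[OF x] w[OF x] dp[OF x] by (intro continuous_intros DERIV_isCont) auto
  qed (use rho in auto)
  then obtain Y where Y: "(Y has_real_derivative - w r / p r) (at r)" if "r \<in> {0<..<\<rho>}" for r
    by (auto simp: has_real_derivative_iff_has_vector_derivative)
  define y where "y r = exp (Y r)" for r
  have dy: "(y has_real_derivative - w r / p r * y r) (at r)" if "r \<in> {0<..<\<rho>}" for r
    unfolding y_def[abs_def] by (auto intro!: derivative_eq_intros Y[OF that])
  define h where "h r = (real n - 1) / r + deriv V r / V r" for r
  have ddy: "((\<lambda>r. - w r / p r * y r) has_real_derivative - h r * (- w r / p r * y r) - W r / V r * y r) (at r)"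
    if r: "r \<in> {0<..<\<rho>}" for r
  proof -
    have W: "W r / V r = r ^ (n - 1) * W r / p r" using r by (simp add: p_def)
    have "((\<lambda>r. w r / p r) has_real_derivative
        (((w r)\<^sup>2 / p r + r ^ (n - 1) * W r) * p r - w r * (p r * h r)) / (p r * p r)) (at r)"
      using p[OF r] dp[OF r] w[OF r] unfolding h_def p_def[symmetric] by (intro DERIV_divide) auto
    then have 1: "((\<lambda>r. w r / p r) has_real_derivative (w r / p r)\<^sup>2 + W r / V r - h r * (w r / p r)) (at r)"
      by (rule DERIV_cong) (use p[OF r] in \<open>simp add: W field_simps power2_eq_square\<close>)
    show ?thesis
      using DERIV_mult[OF DERIV_minus[OF 1] dy[OF r]]
      by (simp add: algebra_simps power2_eq_square)
  qed
  have ode: "- h r * x - z + ((real n - 1) / r + deriv V r / V r) * x + z = 0" for r x z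
    unfolding h_def by (simp add: algebra_simps)
  show ?thesis
    unfolding has_positive_solution_def bessel_solution_def
  proof (rule exI[of _ y], intro conjI ballI, rule exI[of _ "\<lambda>r. - w r / p r * y r"],
      rule exI[of _ "\<lambda>r. - h r * (- w r / p r * y r) - W r / V r * y r"], intro ballI conjI)
    fix r assume r: "r \<in> {0<..<\<rho>}"
    show "(y has_real_derivative - w r / p r * y r) (at r)"
      "((\<lambda>r. - w r / p r * y r) has_real_derivative - h r * (- w r / p r * y r) - W r / V r * y r) (at r)"
      by (rule dy[OF r], rule ddy[OF r])
    show "- h r * (- w r / p r * y r) - W r / V r * y r
        + ((real n - 1) / r + deriv V r / V r) * (- w r / p r * y r) + W r / V r * y r = 0"
      by (rule ode)
  qed (simp add: y_def)
qed

text \<open>For w = - p y' / y the quotient rule gives - (p y')' / y + p (y'/y)^2; the first summand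
  is q by the equation, the second is w^2 / p.\<close>

lemma positive_solution_imp_riccati:
  fixes V W :: "real \<Rightarrow> real"
  assumes n: "n \<ge> 1" and V: "\<And>r. r \<in> {0<..<\<rho>} \<Longrightarrow> V r > 0"
    and dV: "\<And>r. r \<in> {0<..<\<rho>} \<Longrightarrow> (V has_real_derivative deriv V r) (at r)"
    and sol: "has_positive_solution n V W \<rho>"
  obtains w where "\<And>r. r \<in> {0<..<\<rho>} \<Longrightarrow>
      (w has_real_derivative (w r)\<^sup>2 / (r ^ (n - 1) * V r) + r ^ (n - 1) * W r) (at r)"
proof -
  obtain y y' y'' where y: "\<And>r. r \<in> {0<..<\<rho>} \<Longrightarrow> y r > 0"
    and dy: "\<And>r. r \<in> {0<..<\<rho>} \<Longrightarrow> (y has_real_derivative y' r) (at r)"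
    and ddy: "\<And>r. r \<in> {0<..<\<rho>} \<Longrightarrow> (y' has_real_derivative y'' r) (at r)"
    and ode: "\<And>r. r \<in> {0<..<\<rho>} \<Longrightarrow> y'' r + ((real n - 1) / r + deriv V r / V r) * y' r + W r / V r * y r = 0"
    using sol unfolding has_positive_solution_def bessel_solution_def by blast
  define p where "p r = r ^ (n - 1) * V r" for r
  define w where "w r = - (p r * y' r) / y r" for r
  have "(w has_real_derivative (w r)\<^sup>2 / p r + r ^ (n - 1) * W r) (at r)" if r: "r \<in> {0<..<\<rho>}" for r
  proof -
    define h where "h = (real n - 1) / r + deriv V r / V r"
    have p: "p r > 0" using V[OF r] r by (simp add: p_def)
    have dp: "(p has_real_derivative p r * h) (at r)"
      unfolding p_def[abs_def] h_def using r V[OF r] dV[OF r] n by (intro has_real_derivative_weight) auto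
    have "((\<lambda>r. - (p r * y' r)) has_real_derivative - (p r * h * y' r + y'' r * p r)) (at r)"
      by (rule DERIV_minus[OF DERIV_mult[OF dp ddy[OF r]]])
    also have "- (p r * h * y' r + y'' r * p r) = p r * (W r / V r) * y r"
    proof -
      have "y'' r = - h * y' r - W r / V r * y r" using ode[OF r] unfolding h_def by linarith
      then show ?thesis by (simp only:) (simp add: algebra_simps)
    qed
    also have "p r * (W r / V r) = r ^ (n - 1) * W r" using V[OF r] by (simp add: p_def)
    finally have "((\<lambda>r. - (p r * y' r)) has_real_derivative r ^ (n - 1) * W r * y r) (at r)" .
    from DERIV_divide[OF this dy[OF r]]
    show ?thesis unfolding w_def[abs_def]
      by (rule DERIV_cong) (use y[OF r] p in \<open>auto simp: field_simps power2_eq_square\<close>)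
  qed
  then show ?thesis by (intro that[of w]) (simp add: p_def)
qed

section \<open>Smooth functions\<close>

text \<open>The extra power of u strengthens the induction: the step from P to a + u P is absorbed
  by raising the exponent k.\<close>

lemma tendsto_poly_exp_0:
  fixes P :: "real poly"
  shows "((\<lambda>u. u ^ k * poly P u * exp (- u)) \<longlongrightarrow> 0) at_top"
proof (induction P arbitrary: k)
  case 0
  then show ?case by simp
next
  case (pCons a P)
  have "((\<lambda>u. a * (u ^ k / exp u) + u ^ Suc k * poly P u * exp (- u)) \<longlongrightarrow> a * 0 + 0) at_top"
    by (intro tendsto_add tendsto_mult tendsto_const tendsto_power_div_exp_0 pCons.IH)
  then show ?case by (simp add: algebra_simps exp_minus divide_inverse)
qed

text \<open>The derivatives of \<open>exp (- 1 / x)\<close> are all of the form \<open>P (1 / x) exp (- 1 / x)\<close>.\<close>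

definition flat :: "real poly \<Rightarrow> real \<Rightarrow> real" where
  "flat P x = (if x > 0 then poly P (1 / x) * exp (- (1 / x)) else 0)"

text \<open>With u = 1/x one has d/dx = - u^2 d/du, and applying this to P(u) exp(-u) produces the
  polynomial u^2 (P - P').\<close>

definition flat_deriv :: "real poly \<Rightarrow> real poly" where
  "flat_deriv P = monom 1 2 * (P - pderiv P)"

lemma has_real_derivative_flat: "(flat P has_real_derivative flat (flat_deriv P) x) (at x)"
proof -
  consider "x < 0" | "x > 0" | "x = 0" by linarith
  then show ?thesis
  proof cases
    case 1
    have "((\<lambda>z::real. 0) has_real_derivative 0) (at x)" by simp
    then have "(flat P has_real_derivative 0) (at x)"
      by (rule has_field_derivative_transform_within_open[of _ _ _ "{..<0}"]) (use 1 in \<open>auto simp: flat_def\<close>)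
    then show ?thesis using 1 by (simp add: flat_def)
  next
    case 2
    have i: "((\<lambda>z. 1 / z) has_real_derivative - ((1 / x)^2)) (at x)"
      using 2 by (auto intro!: derivative_eq_intros simp: power2_eq_square)
    have "((\<lambda>z. poly P (1 / z) * exp (- (1 / z))) has_real_derivative
        (poly (pderiv P) (1 / x) * (- ((1 / x)^2))) * exp (- (1 / x)) + (exp (- (1 / x)) * - (- ((1 / x)^2))) * poly P (1 / x)) (at x)"
      by (intro DERIV_mult DERIV_chain2[OF poly_DERIV i] DERIV_chain2[OF DERIV_exp] DERIV_minus i)
    also have "(poly (pderiv P) (1 / x) * (- ((1 / x)^2))) * exp (- (1 / x)) + (exp (- (1 / x)) * - (- ((1 / x)^2))) * poly P (1 / x)
      = flat (flat_deriv P) x"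
      using 2 by (simp add: flat_def flat_deriv_def poly_monom algebra_simps)
    finally show ?thesis
      by (rule has_field_derivative_transform_within_open[of _ _ _ "{0<..}"]) (use 2 in \<open>auto simp: flat_def\<close>)
  next
    case 3
    have "((\<lambda>y. flat P y / y) \<longlongrightarrow> 0) (at_right 0)"
    proof -
      \<comment> \<open>In terms of u = 1/y the difference quotient at 0 is u P(u) exp(-u); the
        exponent 1 accounts for the division by y.\<close>
      have "((\<lambda>y::real. (inverse y) ^ 1 * poly P (inverse y) * exp (- inverse y)) \<longlongrightarrow> 0) (at_right 0)"
        by (rule filterlim_compose[OF tendsto_poly_exp_0 filterlim_inverse_at_top_right])
      then show ?thesis
      proof (rule Lim_transform_eventually)
        show "\<forall>\<^sub>F y in at_right (0::real). (inverse y) ^ 1 * poly P (inverse y) * exp (- inverse y) = flat P y / y"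
          using eventually_at_right_less[of "0::real"] by eventually_elim (simp add: flat_def field_simps)
      qed
    qed
    moreover have "((\<lambda>y. flat P y / y) \<longlongrightarrow> 0) (at_left 0)"
      by (rule tendsto_eventually) (auto simp: flat_def eventually_at_filter)
    ultimately show ?thesis using 3 by (simp add: has_field_derivative_iff filterlim_at_split flat_def)
  qed
qed

lemma flat_1_pos: "x > 0 \<Longrightarrow> flat 1 x > 0" and flat_nonpos: "x \<le> 0 \<Longrightarrow> flat P x = 0"
  by (auto simp: flat_def)

section \<open>Closure properties of smooth functions on the whole space\<close>

lemma Ck_on_Suc_imp: "Ck_on (Suc k) f S \<Longrightarrow> Ck_on k f S"
proof (induction k arbitrary: f)
  case 0
  then have "\<forall>x\<in>S. isCont f x" by (simp add: differentiable_imp_continuous_within)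
  then show ?case by (simp add: continuous_at_imp_continuous_on)
next
  case (Suc k)
  note * = Ck_on.simps(2)[THEN iffD1, OF Suc.prems]
  from Suc.IH[OF spec[OF conjunct2[OF *]]] conjunct1[OF *]
  show ?case by (subst Ck_on.simps(2)) blast
qed

lemma Ck_on_const [simp]: "Ck_on k (\<lambda>x. c) S"
  by (induction k arbitrary: c) (auto simp: frechet_derivative_const)

lemma frechet_derivative_eqI: "(f has_derivative f') (at x) \<Longrightarrow> frechet_derivative f (at x) = f'"
  by (metis frechet_derivative_at)

text \<open>\<open>Ck_on\<close> speaks of the chosen \<open>frechet_derivative\<close>. By
  uniqueness any explicit candidate equals it, so the inductions below handle only derivative
  formulas.\<close>

lemma Ck_on_UNIV_SucI:
  assumes "\<And>x. (f has_derivative f' x) (at x)" "\<And>v. Ck_on k (\<lambda>x. f' x v) UNIV"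
  shows "Ck_on (Suc k) f UNIV"
  using assms frechet_derivative_eqI[OF assms(1)] by (auto simp: differentiable_def)

lemma Ck_on_UNIV_has_derivative:
  "Ck_on (Suc k) f UNIV \<Longrightarrow> (f has_derivative frechet_derivative f (at x)) (at x)"
  using frechet_derivative_works by auto

lemma Ck_on_UNIV_add:
  "Ck_on k f UNIV \<Longrightarrow> Ck_on k g UNIV \<Longrightarrow> Ck_on k (\<lambda>x. f x + g x) UNIV"
proof (induction k arbitrary: f g)
  case 0
  then show ?case by (auto intro: continuous_on_add)
next
  case (Suc k)
  show ?case
  proof (rule Ck_on_UNIV_SucI)
    show "((\<lambda>x. f x + g x) has_derivative (\<lambda>v. frechet_derivative f (at x) v + frechet_derivative g (at x) v)) (at x)" for x
      by (intro has_derivative_add Ck_on_UNIV_has_derivative[OF Suc.prems(1)] Ck_on_UNIV_has_derivative[OF Suc.prems(2)])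
    show "Ck_on k (\<lambda>x. frechet_derivative f (at x) v + frechet_derivative g (at x) v) UNIV" for v
      using Suc.prems by (intro Suc.IH) auto
  qed
qed

lemma Ck_on_UNIV_mult:
  "Ck_on k f UNIV \<Longrightarrow> Ck_on k g UNIV \<Longrightarrow> Ck_on k (\<lambda>x. f x * g x) UNIV"
proof (induction k arbitrary: f g)
  case 0
  then show ?case by (auto intro: continuous_on_mult)
next
  case (Suc k)
  show ?case
  proof (rule Ck_on_UNIV_SucI)
    show "((\<lambda>x. f x * g x) has_derivative (\<lambda>v. f x * frechet_derivative g (at x) v + frechet_derivative f (at x) v * g x)) (at x)" for x
      by (intro has_derivative_mult Ck_on_UNIV_has_derivative[OF Suc.prems(1)] Ck_on_UNIV_has_derivative[OF Suc.prems(2)])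
    show "Ck_on k (\<lambda>x. f x * frechet_derivative g (at x) v + frechet_derivative f (at x) v * g x) UNIV" for v
      using Suc.prems Ck_on_Suc_imp[OF Suc.prems(1)] Ck_on_Suc_imp[OF Suc.prems(2)]
      by (intro Ck_on_UNIV_add Suc.IH) auto
  qed
qed

lemma smooth_on_UNIV_mult:
  "smooth_on f UNIV \<Longrightarrow> smooth_on g UNIV \<Longrightarrow> smooth_on (\<lambda>x. f x * g x) UNIV"
  by (auto simp: smooth_on_def intro: Ck_on_UNIV_mult)

text \<open>The chain rule replaces h j by h (j + 1) and multiplies by a derivative of f. Supplying
  the whole sequence of derivatives of the outer function lets the induction on k run for all j at
  once.\<close>

lemma Ck_on_UNIV_compose:
  fixes h :: "nat \<Rightarrow> real \<Rightarrow> real"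
  assumes h: "\<And>j t. (h j has_real_derivative h (Suc j) t) (at t)"
  shows "Ck_on k f UNIV \<Longrightarrow> Ck_on k (\<lambda>x. h j (f x)) UNIV"
proof (induction k arbitrary: j)
  case 0
  have "continuous_on UNIV (h j)" by (meson h DERIV_isCont continuous_at_imp_continuous_on)
  with 0 show ?case by (auto intro: continuous_on_compose2)
next
  case (Suc k)
  show ?case
  proof (rule Ck_on_UNIV_SucI)
    show "((\<lambda>x. h j (f x)) has_derivative (\<lambda>v. h (Suc j) (f x) * frechet_derivative f (at x) v)) (at x)" for x
      using has_derivative_compose[OF Ck_on_UNIV_has_derivative[OF Suc.prems] h[unfolded has_field_derivative_def]]
      by simp
    show "Ck_on k (\<lambda>x. h (Suc j) (f x) * frechet_derivative f (at x) v) UNIV" for v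
      using Suc.prems by (intro Ck_on_UNIV_mult Suc.IH Ck_on_Suc_imp[OF Suc.prems]) auto
  qed
qed

lemma smooth_on_UNIV_compose:
  fixes h :: "nat \<Rightarrow> real \<Rightarrow> real"
  assumes "\<And>j t. (h j has_real_derivative h (Suc j) t) (at t)" "smooth_on f UNIV"
  shows "smooth_on (\<lambda>x. h 0 (f x)) UNIV"
  using assms(2) unfolding smooth_on_def by (intro allI Ck_on_UNIV_compose[where h = h and j = 0] assms(1)) blast

text \<open>Radial test functions are built on x \<bullet> x because the norm is not differentiable
  at the origin. The first derivative is linear in x, the second is constant.\<close>

lemma smooth_on_UNIV_affine_power2:
  fixes a b :: real
  shows "smooth_on (\<lambda>x::'a::euclidean_space. a + b * (x \<bullet> x)) UNIV"
proof -
  have lin: "Ck_on k (\<lambda>x::'a. b * (2 * (x \<bullet> v))) UNIV" for k and v :: 'a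
  proof (cases k)
    case 0
    then show ?thesis by (auto intro!: continuous_intros)
  next
    case (Suc j)
    show ?thesis unfolding Suc
      by (rule Ck_on_UNIV_SucI[where f' = "\<lambda>x h. b * (2 * (h \<bullet> v))"]) (auto intro!: derivative_eq_intros)
  qed
  have "Ck_on k (\<lambda>x::'a. a + b * (x \<bullet> x)) UNIV" for k
  proof (cases k)
    case 0
    then show ?thesis by (auto intro!: continuous_intros)
  next
    case (Suc j)
    show ?thesis unfolding Suc
      by (rule Ck_on_UNIV_SucI[where f' = "\<lambda>x h. b * (2 * (x \<bullet> h))"])
        (use lin in \<open>auto intro!: derivative_eq_intros simp: inner_commute\<close>)
  qed
  then show ?thesis by (simp add: smooth_on_def)
qed

lemma smooth_on_UNIV_flat: "smooth_on f UNIV \<Longrightarrow> smooth_on (\<lambda>x. flat 1 (f x)) UNIV"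
  using smooth_on_UNIV_compose[of "\<lambda>j. flat ((flat_deriv ^^ j) 1)" f] by (simp add: has_real_derivative_flat)

lemma smooth_on_UNIV_poly: "smooth_on f UNIV \<Longrightarrow> smooth_on (\<lambda>x. poly P (f x)) UNIV"
  using smooth_on_UNIV_compose[of "\<lambda>j. poly ((pderiv ^^ j) P)" f] by (simp add: poly_DERIV)

lemma gradient_power2_norm:
  fixes g :: "real \<Rightarrow> real" and x :: "'a::euclidean_space"
  assumes "(g has_real_derivative g') (at (x \<bullet> x))"
  shows "gradient (\<lambda>x. g (x \<bullet> x)) x = (2 * g') *\<^sub>R x"
proof -
  have "((\<lambda>x. x \<bullet> x) has_derivative (\<lambda>v. 2 * (x \<bullet> v))) (at x)"
    by (auto intro!: derivative_eq_intros simp: inner_commute)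
  from has_derivative_compose[OF this assms[unfolded has_field_derivative_def]]
  have "frechet_derivative (\<lambda>x. g (x \<bullet> x)) (at x) = (\<lambda>v. g' * (2 * (x \<bullet> v)))"
    by (rule frechet_derivative_eqI)
  then have "gradient (\<lambda>x. g (x \<bullet> x)) x = (\<Sum>b\<in>Basis. (2 * g') *\<^sub>R ((x \<bullet> b) *\<^sub>R b))"
    unfolding gradient_def by (simp add: mult_ac)
  also have "\<dots> = (2 * g') *\<^sub>R x"
    unfolding scaleR_sum_right[symmetric] euclidean_representation ..
  finally show ?thesis .
qed

text \<open>Approximate h' by a polynomial and integrate it with the constant matched to h at A; the
  mean value estimate then controls the functions themselves.\<close>

lemma poly_C1_approximation:
  fixes h h' :: "real \<Rightarrow> real"
  assumes AB: "A < B" and h: "\<And>t. t \<in> {A..B} \<Longrightarrow> (h has_real_derivative h' t) (at t within {A..B})"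
    and h': "continuous_on {A..B} h'" and e: "e > 0"
  obtains P where "\<And>t. t \<in> {A..B} \<Longrightarrow> \<bar>poly P t - h t\<bar> \<le> e \<and> \<bar>poly (pderiv P) t - h' t\<bar> \<le> e"
proof -
  \<comment> \<open>The error d in the derivative grows to at most d (B - A) in the function, so
    both d and d (B - A) are kept below e.\<close>
  define d where "d = min e (e / (B - A))"
  have d: "d > 0" "d \<le> e" "d * (B - A) \<le> e" using AB e by (auto simp: d_def min_def field_simps)
  obtain g where g: "real_polynomial_function g" "\<And>t. t \<in> {A..B} \<Longrightarrow> \<bar>h' t - g t\<bar> < d"
    using Stone_Weierstrass_real_polynomial_function[OF compact_Icc h' d(1)] by blast
  obtain a n where g_eq: "g = (\<lambda>x. \<Sum>i\<le>n. a i * x ^ i)"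
    using g(1) unfolding real_polynomial_function_iff_sum by blast
  define P0 where "P0 = (\<Sum>i\<le>n. monom (a i / real (Suc i)) (Suc i))"
  define P where "P = P0 + [:h A - poly P0 A:]"
  have dP: "poly (pderiv P) t = g t" for t
    by (simp add: P_def P0_def pderiv_add pderiv_pCons higher_pderiv_sum[of 1, simplified] pderiv_monom poly_sum poly_monom g_eq del: of_nat_Suc)
  have PA: "poly P A = h A" by (simp add: P_def)
  show ?thesis
  proof (rule that)
    fix t assume t: "t \<in> {A..B}"
    have "norm ((poly P t - h t) - (poly P A - h A)) \<le> d * norm (t - A)"
    proof (rule field_differentiable_bound[of "{A..B}" _ "\<lambda>t. poly (pderiv P) t - h' t"])
      show "((\<lambda>t. poly P t - h t) has_field_derivative poly (pderiv P) z - h' z) (at z within {A..B})"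
        if "z \<in> {A..B}" for z
        by (rule DERIV_diff[OF has_field_derivative_at_within[OF poly_DERIV] h[OF that]])
      show "norm (poly (pderiv P) z - h' z) \<le> d" if "z \<in> {A..B}" for z
        using g(2)[OF that] by (simp add: dP)
    qed (use t in auto)
    also have "\<dots> \<le> d * (B - A)" using t d(1) by (intro mult_left_mono) auto
    finally have "\<bar>poly P t - h t\<bar> \<le> e" using d(3) by (simp add: PA)
    moreover have "\<bar>poly (pderiv P) t - h' t\<bar> \<le> e" using g(2)[OF t] d(2) by (simp add: dP)
    ultimately show "\<bar>poly P t - h t\<bar> \<le> e \<and> \<bar>poly (pderiv P) t - h' t\<bar> \<le> e" ..
  qed
qed

section \<open>Failure of the Hardy inequality\<close>

text \<open>The image of Lebesgue measure under the norm has density n \<omega> r^(n-1) on [0,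
  \<infinity>), with \<omega> the volume of the unit ball. The two measures are compared on
  half-lines, whose preimages are closed balls or empty.\<close>

lemma nn_integral_radial:
  fixes f :: "real \<Rightarrow> ennreal"
  assumes f: "f \<in> borel_measurable borel"
  shows "(\<integral>\<^sup>+x. f (norm x) \<partial>(lborel :: 'a::euclidean_space measure)) =
    ennreal (real DIM('a) * unit_ball_vol DIM('a)) * (\<integral>\<^sup>+r\<in>{0..}. f r * ennreal (r ^ (DIM('a) - 1)) \<partial>lborel)"
proof -
  define n c where "n = DIM('a)" and "c = real n * unit_ball_vol n"
  have n: "n \<ge> 1" by (simp add: n_def Suc_leI)
  have c: "c \<ge> 0" by (simp add: c_def)
  define d where "d r = ennreal (c * r ^ (n - 1)) * indicator {0..} r" for r :: real
  have [measurable]: "d \<in> borel_measurable lborel" unfolding d_def by measurable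
  have "distr (lborel :: 'a measure) borel norm = density lborel d"
  proof (rule measure_eqI_generator_eq[where E = "range atMost" and \<Omega> = UNIV and A = "\<lambda>i. {..real i}"])
    show "Int_stable (range atMost :: real set set)" by (auto simp: Int_stable_def)
    fix X :: "real set" assume "X \<in> range atMost"
    then obtain z where X: "X = {..z}" by auto
    have 1: "emeasure (distr (lborel :: 'a measure) borel norm) X = emeasure lborel (cball (0::'a) z)"
      by (subst emeasure_distr) (auto simp: X vimage_def cball_def)
    have 2: "emeasure (density lborel d) X = (\<integral>\<^sup>+r. ennreal (c * r ^ (n - 1)) * indicator {0..z} r \<partial>lborel)"
      by (subst emeasure_density) (auto simp: X d_def intro!: nn_integral_cong split: split_indicator)
    show "emeasure (distr (lborel :: 'a measure) borel norm) X = emeasure (density lborel d) X"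
    proof (cases "z \<ge> 0")
      case True
      have "(\<integral>\<^sup>+r. ennreal (c * r ^ (n - 1)) * indicator {0..z} r \<partial>lborel) = unit_ball_vol n * z ^ n - unit_ball_vol n * 0 ^ n"
      proof (rule nn_integral_FTC_Icc[where F = "\<lambda>r. unit_ball_vol n * r ^ n"])
        show "((\<lambda>r. unit_ball_vol n * r ^ n) has_real_derivative c * x ^ (n - 1)) (at x)" for x :: real
          by (auto intro!: derivative_eq_intros simp: c_def)
      qed (use True c in auto)
      then show ?thesis using 1 2 True n by (simp add: emeasure_cball n_def)
    next
      case False
      then have "(\<integral>\<^sup>+r. ennreal (c * r ^ (n - 1)) * indicator {0..z} r \<partial>lborel) = 0"
        by simp
      then show ?thesis using 1 2 False by simp
    qed
  next
    show "(\<Union>i. {..real i}) = UNIV" by (auto intro: real_arch_simple)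
    show "emeasure (distr (lborel :: 'a measure) borel norm) {..real i} \<noteq> \<infinity>" for i
    proof -
      have "norm -` {..real i} = cball (0::'a) (real i)" by (auto simp: cball_def)
      then show ?thesis by (subst emeasure_distr) (auto simp: emeasure_cball)
    qed
  qed (auto simp: borel_eq_atMost)
  then have "(\<integral>\<^sup>+x. f (norm x) \<partial>(lborel :: 'a measure)) = (\<integral>\<^sup>+r. f r \<partial>density lborel d)"
    using f nn_integral_distr[of norm "lborel :: 'a measure" borel f] by simp
  also have "\<dots> = (\<integral>\<^sup>+r. d r * f r \<partial>lborel)" using f by (intro nn_integral_density) auto
  also have "\<dots> = (\<integral>\<^sup>+r. ennreal c * (f r * ennreal (r ^ (n - 1)) * indicator {0..} r) \<partial>lborel)"
    using c by (intro nn_integral_cong) (auto simp: d_def ennreal_mult mult_ac split: split_indicator)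
  also have "\<dots> = ennreal c * (\<integral>\<^sup>+r. f r * ennreal (r ^ (n - 1)) * indicator {0..} r \<partial>lborel)"
    using f by (intro nn_integral_cmult) auto
  finally show ?thesis by (simp add: c_def n_def)
qed

lemma nn_integral_radial_annulus:
  fixes f :: "real \<Rightarrow> real"
  assumes ab: "0 < a" "a \<le> b" and f: "continuous_on {a..b} f" "\<And>r. r \<in> {a..b} \<Longrightarrow> f r \<ge> 0"
  shows "(\<integral>\<^sup>+x. ennreal (f (norm x)) * indicator {a..b} (norm x) \<partial>(lborel :: 'a::euclidean_space measure)) =
    ennreal (real DIM('a) * unit_ball_vol DIM('a) * integral {a..b} (\<lambda>r. r ^ (DIM('a) - 1) * f r))"
proof -
  define g where "g r = r ^ (DIM('a) - 1) * f r" for r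
  have m: "(\<lambda>r. ennreal (f r) * indicator {a..b} r) \<in> borel_measurable borel"
  proof -
    have "(\<lambda>x. ennreal (indicator {a..b} x *\<^sub>R f x)) \<in> borel_measurable borel"
      by (auto intro!: measurable_compose[OF _ measurable_ennreal] borel_measurable_continuous_on_indicator f simp del: real_scaleR_def)
    also have "(\<lambda>x. ennreal (indicator {a..b} x *\<^sub>R f x)) = (\<lambda>x. ennreal (f x) * indicator {a..b} x)"
      by (auto simp: fun_eq_iff split: split_indicator)
    finally show ?thesis .
  qed
  have i: "set_integrable lborel {a..b} g"
    unfolding g_def by (intro borel_integrable_atLeastAtMost' continuous_intros f)
  have nn: "0 \<le> g r" if "r \<in> {a..b}" for r using f(2)[OF that] that ab by (auto simp: g_def)
  have "(\<integral>\<^sup>+r\<in>{0..}. (ennreal (f r) * indicator {a..b} r) * ennreal (r ^ (DIM('a) - 1)) \<partial>lborel)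
     = (\<integral>\<^sup>+r. ennreal (indicator {a..b} r *\<^sub>R g r) \<partial>lborel)"
    using ab f(2) by (intro nn_integral_cong) (auto simp: g_def ennreal_mult mult_ac split: split_indicator)
  also have "\<dots> = ennreal (integral {a..b} g)"
    using nn i set_borel_integral_eq_integral(2)[OF i] unfolding set_lebesgue_integral_def set_integrable_def
    by (subst nn_integral_eq_integral) (auto split: split_indicator)
  finally have *: "(\<integral>\<^sup>+r\<in>{0..}. (ennreal (f r) * indicator {a..b} r) * ennreal (r ^ (DIM('a) - 1)) \<partial>lborel)
    = ennreal (integral {a..b} g)" .
  have "0 \<le> integral {a..b} g"
    using set_borel_integral_eq_integral(1)[OF i] nn by (rule integral_nonneg)
  then show ?thesis
    unfolding nn_integral_radial[OF m] * g_def[symmetric] by (intro ennreal_mult[symmetric]) auto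
qed

text \<open>Write \<open>\<phi>(r) = \<theta>(r\<^sup>2) h(r\<^sup>2)\<close> with a smooth bump \<open>\<theta>\<close> positive on the support of \<open>\<phi>\<close>, and replace
  \<open>h\<close>, which is only \<open>C\<^sup>1\<close>, by a polynomial that is close to it in \<open>C\<^sup>1\<close>.\<close>

lemma negative_smooth_energy:
  fixes p q \<phi> \<phi>' :: "real \<Rightarrow> real"
  assumes ab: "0 < a" "a < b" "b < \<rho>"
    and pc: "continuous_on {0<..<\<rho>} p" and qc: "continuous_on {0<..<\<rho>} q"
    and d\<phi>: "\<And>r. r \<in> {0<..<\<rho>} \<Longrightarrow> (\<phi> has_real_derivative \<phi>' r) (at r)"
    and \<phi>'c: "continuous_on {0<..<\<rho>} \<phi>'"
    and zero: "\<And>r. r \<in> {0<..<\<rho>} - {a<..<b} \<Longrightarrow> \<phi> r = 0 \<and> \<phi>' r = 0"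
    and neg: "integral {a..b} (\<lambda>r. p r * (\<phi>' r)\<^sup>2 - q r * (\<phi> r)\<^sup>2) < 0"
  obtains a' b' g g' where "0 < a'" "a' < b'" "b' < \<rho>"
    and "smooth_on (\<lambda>x::'a::euclidean_space. g (x \<bullet> x)) UNIV"
    and "\<And>t. (g has_real_derivative g' t) (at t)" "continuous_on UNIV g'"
    and "\<And>r. 0 \<le> r \<Longrightarrow> r \<notin> {a'..b'} \<Longrightarrow> g (r\<^sup>2) = 0 \<and> g' (r\<^sup>2) = 0"
    and "integral {a'..b'} (\<lambda>r. p r * (2 * r * g' (r\<^sup>2))\<^sup>2 - q r * (g (r\<^sup>2))\<^sup>2) < 0"
proof -
  \<comment> \<open>The interval is enlarged strictly on both sides, so that the bump \<theta>,
    which vanishes at the new ends, stays positive on the closed support of \<phi>.\<close>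
  define a' b' where "a' = a / 2" and "b' = (b + \<rho>) / 2"
  have ab': "0 < a'" "a' < a" "b < b'" "b' < \<rho>" "a' < b'" using ab by (auto simp: a'_def b'_def)
  define A B where "A = a'\<^sup>2" and "B = b'\<^sup>2"
  define \<theta> where "\<theta> t = flat 1 (t - A) * flat 1 (B - t)" for t
  define \<theta>' where "\<theta>' t = flat (flat_deriv 1) (t - A) * flat 1 (B - t) - flat 1 (t - A) * flat (flat_deriv 1) (B - t)" for t
  have AB: "0 < A" "A < a\<^sup>2" "a\<^sup>2 < b\<^sup>2" "b\<^sup>2 < B" "A < B" "B < \<rho>\<^sup>2"
    using ab ab' by (auto simp: A_def B_def power2_eq_square intro!: mult_strict_mono)
  have flat_c: "continuous_on S (\<lambda>x. flat P (f x))" if "continuous_on S f" for S P and f :: "real \<Rightarrow> real"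
  proof -
    have "continuous_on UNIV (flat P)"
      by (meson has_real_derivative_flat DERIV_isCont continuous_at_imp_continuous_on)
    then show ?thesis using that by (rule continuous_on_compose2) auto
  qed
  have d\<theta>: "(\<theta> has_real_derivative \<theta>' t) (at t)" for t
  proof -
    have "((\<lambda>t. flat 1 (t - A)) has_real_derivative flat (flat_deriv 1) (t - A) * 1) (at t)"
      by (rule DERIV_chain2[OF has_real_derivative_flat]) (auto intro!: derivative_eq_intros)
    moreover have "((\<lambda>t. flat 1 (B - t)) has_real_derivative flat (flat_deriv 1) (B - t) * (- 1)) (at t)"
      by (rule DERIV_chain2[OF has_real_derivative_flat]) (auto intro!: derivative_eq_intros)
    ultimately show ?thesis unfolding \<theta>_def[abs_def] \<theta>'_def
      by (rule DERIV_cong[OF DERIV_mult]) (simp add: mult_ac)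
  qed
  have \<theta>'c: "continuous_on S \<theta>'" for S unfolding \<theta>'_def by (intro continuous_intros flat_c)
  have \<theta>c: "continuous_on S \<theta>" for S unfolding \<theta>_def by (intro continuous_intros flat_c)
  have \<theta>0: "\<theta> t = 0 \<and> \<theta>' t = 0" if "t \<notin> {A<..<B}" for t
    using that by (cases "t \<le> A") (auto simp: \<theta>_def \<theta>'_def flat_nonpos)
  have \<theta>pos: "\<theta> t > 0" if "t \<in> {A<..<B}" for t
    using that by (auto simp: \<theta>_def intro!: mult_pos_pos flat_1_pos)
  \<comment> \<open>Where \<theta> vanishes the numerators vanish too, and division by zero returns
    0. Thus h is C^1 on all of (0, \<rho>^2), including the ends A and B needed for approximation on
    the closed interval.\<close>
  define h where "h t = \<phi> (sqrt t) / \<theta> t" for t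
  define h' where "h' t = (\<phi>' (sqrt t) / (2 * sqrt t) * \<theta> t - \<phi> (sqrt t) * \<theta>' t) / (\<theta> t * \<theta> t)" for t
  have sq_in: "sqrt t \<in> {0<..<\<rho>}" if "t \<in> {0<..<\<rho>\<^sup>2}" for t
    using that ab real_sqrt_less_mono[of t "\<rho>\<^sup>2"] by (auto simp: real_sqrt_abs)
  have h_out: "h t = 0 \<and> h' t = 0" if t: "t \<in> {0<..<\<rho>\<^sup>2} - {a\<^sup>2..b\<^sup>2}" for t
  proof -
    have "sqrt t < a \<or> b < sqrt t"
      using t ab by (auto simp: not_le intro: real_less_rsqrt real_less_lsqrt)
    then have "\<phi> (sqrt t) = 0 \<and> \<phi>' (sqrt t) = 0" using sq_in[of t] t by (intro zero) auto
    then show ?thesis by (simp add: h_def h'_def)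
  qed
  have out_open: "open ({0<..<\<rho>\<^sup>2} - {a\<^sup>2..b\<^sup>2})" by (intro open_Diff) auto
  have h_deriv: "(h has_real_derivative h' t) (at t) \<and> isCont h' t" if t: "t \<in> {0<..<\<rho>\<^sup>2}" for t
  proof (cases "t \<in> {a\<^sup>2..b\<^sup>2}")
    case False
    have "((\<lambda>t. 0) has_real_derivative 0) (at t)" by simp
    then have "(h has_real_derivative 0) (at t)"
      by (rule has_field_derivative_transform_within_open[OF _ out_open]) (use t False h_out in auto)
    moreover have "continuous_on ({0<..<\<rho>\<^sup>2} - {a\<^sup>2..b\<^sup>2}) h'"
      by (rule continuous_on_eq[of _ "\<lambda>_. 0"]) (use h_out in auto)
    then have "isCont h' t" using t False out_open by (simp add: continuous_on_eq_continuous_at)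
    ultimately show ?thesis using h_out[of t] t False by simp
  next
    case True
    then have tAB: "t \<in> {A<..<B}" using AB by auto
    have ds: "(sqrt has_real_derivative inverse (sqrt t) / 2) (at t)" using t by (intro DERIV_real_sqrt) auto
    have "((\<lambda>t. \<phi> (sqrt t)) has_real_derivative \<phi>' (sqrt t) / (2 * sqrt t)) (at t)"
      by (rule DERIV_cong[OF DERIV_chain2[OF d\<phi>[OF sq_in[OF t]] ds]]) (simp add: inverse_eq_divide)
    from DERIV_divide[OF this d\<theta>] have "(h has_real_derivative h' t) (at t)"
      using \<theta>pos[OF tAB] unfolding h_def[abs_def] h'_def by auto
    moreover have "isCont h' t"
    proof -
      have sub: "{A<..<B} \<subseteq> {0<..<\<rho>\<^sup>2}" using AB by auto
      have "continuous_on {A<..<B} (\<lambda>t. \<phi>' (sqrt t))"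
        by (rule continuous_on_compose2[OF \<phi>'c]) (use sub sq_in in \<open>auto intro!: continuous_intros\<close>)
      moreover have "continuous_on {0<..<\<rho>} \<phi>" using d\<phi> by (meson DERIV_isCont continuous_at_imp_continuous_on)
      then have "continuous_on {A<..<B} (\<lambda>t. \<phi> (sqrt t))"
        by (rule continuous_on_compose2) (use sub sq_in in \<open>auto intro!: continuous_intros\<close>)
      moreover have "\<forall>t\<in>{A<..<B}. 2 * sqrt t \<noteq> 0" "\<forall>t\<in>{A<..<B}. \<theta> t * \<theta> t \<noteq> 0"
        using AB(1) \<theta>pos by (force, metis less_irrefl mult_eq_0_iff)
      ultimately have "continuous_on {A<..<B} h'"
        unfolding h'_def by (intro continuous_intros \<theta>c \<theta>'c)
      then show ?thesis using tAB by (simp add: continuous_on_eq_continuous_at)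
    qed
    ultimately show ?thesis by simp
  qed
  have sub: "{A..B} \<subseteq> {0<..<\<rho>\<^sup>2}" using AB by auto
  have hc: "continuous_on {A..B} h" "continuous_on {A..B} h'"
    using h_deriv sub by (meson DERIV_isCont continuous_at_imp_continuous_on subsetD)+
  have "\<exists>P. \<forall>t\<in>{A..B}. \<bar>poly P t - h t\<bar> \<le> inverse (real (Suc n)) \<and> \<bar>poly (pderiv P) t - h' t\<bar> \<le> inverse (real (Suc n))" for n
  proof -
    have "(h has_real_derivative h' t) (at t within {A..B})" if "t \<in> {A..B}" for t
      using h_deriv sub that by (meson has_field_derivative_at_within subsetD)
    from poly_C1_approximation[OF AB(5) this hc(2), of "inverse (real (Suc n))"]
    show ?thesis by (metis inverse_positive_iff_positive of_nat_0_less_iff zero_less_Suc)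
  qed
  then obtain P where P: "\<And>n t. t \<in> {A..B} \<Longrightarrow> \<bar>poly (P n) t - h t\<bar> \<le> inverse (real (Suc n))"
    and P': "\<And>n t. t \<in> {A..B} \<Longrightarrow> \<bar>poly (pderiv (P n)) t - h' t\<bar> \<le> inverse (real (Suc n))"
    by metis
  \<comment> \<open>The energy density at r of \<theta>(r^2) f(r^2), when f and its derivative take
    the values u and v at r^2; the factor 2 r is the inner derivative.\<close>
  define E where "E u v r = p r * (2 * r * (\<theta>' (r\<^sup>2) * u + \<theta> (r\<^sup>2) * v))\<^sup>2 - q r * (\<theta> (r\<^sup>2) * u)\<^sup>2" for u v r
  have r2: "r\<^sup>2 \<in> {A..B}" if "r \<in> {a'..b'}" for r
    using that ab' unfolding A_def B_def by (auto intro!: power_mono)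
  have sub': "{a'..b'} \<subseteq> {0<..<\<rho>}" using ab' by auto
  have Ec: "continuous_on {a'..b'} (\<lambda>r. E (u (r\<^sup>2)) (v (r\<^sup>2)) r)"
    if "continuous_on {A..B} u" "continuous_on {A..B} v" for u v
  proof -
    have 2: "continuous_on {a'..b'} (\<lambda>r. f (r\<^sup>2))" if "continuous_on {A..B} f" for f :: "real \<Rightarrow> real"
      by (rule continuous_on_compose2[OF that]) (use r2 in \<open>auto intro!: continuous_intros\<close>)
    show ?thesis unfolding E_def
      by (intro continuous_intros continuous_on_subset[OF pc sub'] continuous_on_subset[OF qc sub'] 2 that \<theta>c \<theta>'c)
  qed
  \<comment> \<open>The majorant uses only that the approximations and their derivatives stay within
    1 of h and h'.\<close>
  have lim: "(\<lambda>n. integral {a'..b'} (\<lambda>r. E (poly (P n) (r\<^sup>2)) (poly (pderiv (P n)) (r\<^sup>2)) r))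
      \<longlonglongrightarrow> integral {a'..b'} (\<lambda>r. E (h (r\<^sup>2)) (h' (r\<^sup>2)) r)"
  proof (rule dominated_convergence(2))
    define H where "H r = \<bar>p r\<bar> * (2 * r * (\<bar>\<theta>' (r\<^sup>2)\<bar> * (\<bar>h (r\<^sup>2)\<bar> + 1) + \<bar>\<theta> (r\<^sup>2)\<bar> * (\<bar>h' (r\<^sup>2)\<bar> + 1)))\<^sup>2
        + \<bar>q r\<bar> * (\<bar>\<theta> (r\<^sup>2)\<bar> * (\<bar>h (r\<^sup>2)\<bar> + 1))\<^sup>2" for r
    show "(\<lambda>r. E (poly (P n) (r\<^sup>2)) (poly (pderiv (P n)) (r\<^sup>2)) r) integrable_on {a'..b'}" for n
      by (intro integrable_continuous_real Ec) (auto intro!: continuous_intros)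
    show "H integrable_on {a'..b'}"
    proof -
      have 2: "continuous_on {a'..b'} (\<lambda>r. f (r\<^sup>2))" if "continuous_on {A..B} f" for f :: "real \<Rightarrow> real"
        by (rule continuous_on_compose2[OF that]) (use r2 in \<open>auto intro!: continuous_intros\<close>)
      show ?thesis unfolding H_def
        by (intro integrable_continuous_real continuous_intros continuous_on_subset[OF pc sub']
            continuous_on_subset[OF qc sub'] 2 hc \<theta>c \<theta>'c)
    qed
    show "norm (E (poly (P n) (r\<^sup>2)) (poly (pderiv (P n)) (r\<^sup>2)) r) \<le> H r" if r: "r \<in> {a'..b'}" for n r
    proof -
      define u v where "u = poly (P n) (r\<^sup>2)" and "v = poly (pderiv (P n)) (r\<^sup>2)"
      have "inverse (real (Suc n)) \<le> 1" by (simp add: inverse_le_1_iff)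
      then have uv: "\<bar>u\<bar> \<le> \<bar>h (r\<^sup>2)\<bar> + 1" "\<bar>v\<bar> \<le> \<bar>h' (r\<^sup>2)\<bar> + 1"
        using P[OF r2[OF r], of n] P'[OF r2[OF r], of n] unfolding u_def v_def by linarith+
      have r0: "r > 0" using r ab' by auto
      have "\<bar>2 * r * (\<theta>' (r\<^sup>2) * u + \<theta> (r\<^sup>2) * v)\<bar> \<le> 2 * r * (\<bar>\<theta>' (r\<^sup>2)\<bar> * (\<bar>h (r\<^sup>2)\<bar> + 1) + \<bar>\<theta> (r\<^sup>2)\<bar> * (\<bar>h' (r\<^sup>2)\<bar> + 1))"
      proof -
        have "\<bar>\<theta>' (r\<^sup>2) * u + \<theta> (r\<^sup>2) * v\<bar> \<le> \<bar>\<theta>' (r\<^sup>2)\<bar> * \<bar>u\<bar> + \<bar>\<theta> (r\<^sup>2)\<bar> * \<bar>v\<bar>"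
          by (metis abs_mult abs_triangle_ineq)
        also have "\<dots> \<le> \<bar>\<theta>' (r\<^sup>2)\<bar> * (\<bar>h (r\<^sup>2)\<bar> + 1) + \<bar>\<theta> (r\<^sup>2)\<bar> * (\<bar>h' (r\<^sup>2)\<bar> + 1)"
          by (intro add_mono mult_left_mono uv) auto
        finally show ?thesis using r0 by (simp add: abs_mult)
      qed
      then have 1: "(2 * r * (\<theta>' (r\<^sup>2) * u + \<theta> (r\<^sup>2) * v))\<^sup>2 \<le> (2 * r * (\<bar>\<theta>' (r\<^sup>2)\<bar> * (\<bar>h (r\<^sup>2)\<bar> + 1) + \<bar>\<theta> (r\<^sup>2)\<bar> * (\<bar>h' (r\<^sup>2)\<bar> + 1)))\<^sup>2"
        by (rule abs_le_square_iff[THEN iffD1, OF order_trans[OF _ abs_ge_self]])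
      have "\<bar>\<theta> (r\<^sup>2) * u\<bar> \<le> \<bar>\<theta> (r\<^sup>2)\<bar> * (\<bar>h (r\<^sup>2)\<bar> + 1)"
        unfolding abs_mult by (intro mult_left_mono uv) auto
      then have 2: "(\<theta> (r\<^sup>2) * u)\<^sup>2 \<le> (\<bar>\<theta> (r\<^sup>2)\<bar> * (\<bar>h (r\<^sup>2)\<bar> + 1))\<^sup>2"
        by (rule abs_le_square_iff[THEN iffD1, OF order_trans[OF _ abs_ge_self]])
      have "norm (E u v r) \<le> \<bar>p r\<bar> * (2 * r * (\<theta>' (r\<^sup>2) * u + \<theta> (r\<^sup>2) * v))\<^sup>2 + \<bar>q r\<bar> * (\<theta> (r\<^sup>2) * u)\<^sup>2"
        unfolding E_def real_norm_def by (rule order_trans[OF abs_triangle_ineq4]) (simp add: abs_mult)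
      also have "\<dots> \<le> H r" unfolding H_def by (intro add_mono mult_left_mono 1 2) auto
      finally show ?thesis unfolding u_def v_def .
    qed
    show "(\<lambda>n. E (poly (P n) (r\<^sup>2)) (poly (pderiv (P n)) (r\<^sup>2)) r) \<longlonglongrightarrow> E (h (r\<^sup>2)) (h' (r\<^sup>2)) r" if r: "r \<in> {a'..b'}" for r
    proof -
      have "(\<lambda>n. poly (P n) (r\<^sup>2)) \<longlonglongrightarrow> h (r\<^sup>2)"
        by (rule Lim_transform[OF tendsto_const], rule Lim_null_comparison[OF _ LIMSEQ_inverse_real_of_nat])
          (use P[OF r2[OF r]] in \<open>auto simp: abs_minus_commute\<close>)
      moreover have "(\<lambda>n. poly (pderiv (P n)) (r\<^sup>2)) \<longlonglongrightarrow> h' (r\<^sup>2)"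
        by (rule Lim_transform[OF tendsto_const], rule Lim_null_comparison[OF _ LIMSEQ_inverse_real_of_nat])
          (use P'[OF r2[OF r]] in \<open>auto simp: abs_minus_commute\<close>)
      ultimately show ?thesis unfolding E_def by (intro tendsto_intros)
    qed
  qed
  \<comment> \<open>In the interior \<theta> cancels. At the two ends \<theta> = 0 and the
    cancellation fails, but both sides are 0 there.\<close>
  have E_eq: "E (h (r\<^sup>2)) (h' (r\<^sup>2)) r = p r * (\<phi>' r)\<^sup>2 - q r * (\<phi> r)\<^sup>2" if r: "r \<in> {a'..b'}" for r
  proof (cases "r\<^sup>2 \<in> {A<..<B}")
    case True
    have r0: "r > 0" using r ab' by auto
    have "\<theta> (r\<^sup>2) * h (r\<^sup>2) = \<phi> r" "2 * r * (\<theta>' (r\<^sup>2) * h (r\<^sup>2) + \<theta> (r\<^sup>2) * h' (r\<^sup>2)) = \<phi>' r"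
      using \<theta>pos[OF True] r0 by (simp_all add: h_def h'_def field_simps)
    then show ?thesis by (simp add: E_def)
  next
    case False
    have "r = a' \<or> r = b'"
    proof (rule ccontr)
      assume "\<not> ?thesis"
      then have "a' < r" "r < b'" using r by auto
      then have "r\<^sup>2 \<in> {A<..<B}" unfolding A_def B_def using ab' by (auto intro!: power_strict_mono)
      then show False using False by simp
    qed
    then have "\<phi> r = 0 \<and> \<phi>' r = 0" using ab' ab by (intro zero) auto
    then show ?thesis using \<theta>0[OF False] by (simp add: E_def)
  qed
  have "integral {a'..b'} (\<lambda>r. E (h (r\<^sup>2)) (h' (r\<^sup>2)) r) = integral {a'..b'} (\<lambda>r. p r * (\<phi>' r)\<^sup>2 - q r * (\<phi> r)\<^sup>2)"
    by (rule integral_cong) (rule E_eq)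
  also have "\<dots> = integral {a'..b'} (\<lambda>r. if r \<in> {a..b} then p r * (\<phi>' r)\<^sup>2 - q r * (\<phi> r)\<^sup>2 else 0)"
    by (rule integral_cong) (use zero ab' ab in auto)
  also have "\<dots> = integral {a..b} (\<lambda>r. p r * (\<phi>' r)\<^sup>2 - q r * (\<phi> r)\<^sup>2)"
    unfolding integral_restrict_Int using ab' by (simp add: Int_absorb1)
  finally have "\<forall>\<^sub>F n in sequentially. integral {a'..b'} (\<lambda>r. E (poly (P n) (r\<^sup>2)) (poly (pderiv (P n)) (r\<^sup>2)) r) < 0"
    using order_tendstoD(2)[OF lim, of 0] neg by simp
  then obtain n where n: "integral {a'..b'} (\<lambda>r. E (poly (P n) (r\<^sup>2)) (poly (pderiv (P n)) (r\<^sup>2)) r) < 0"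
    by (auto simp: eventually_sequentially)
  show ?thesis
  proof (rule that[of a' b' "\<lambda>t. \<theta> t * poly (P n) t" "\<lambda>t. \<theta>' t * poly (P n) t + \<theta> t * poly (pderiv (P n)) t"])
    have s: "smooth_on (\<lambda>x::'a. x \<bullet> x) UNIV" "smooth_on (\<lambda>x::'a. x \<bullet> x - A) UNIV" "smooth_on (\<lambda>x::'a. B - x \<bullet> x) UNIV"
      using smooth_on_UNIV_affine_power2[of 0 1] smooth_on_UNIV_affine_power2[of "- A" 1]
        smooth_on_UNIV_affine_power2[of B "-1"] by (simp_all add: algebra_simps)
    show "smooth_on (\<lambda>x::'a. \<theta> (x \<bullet> x) * poly (P n) (x \<bullet> x)) UNIV"
      unfolding \<theta>_def by (intro smooth_on_UNIV_mult smooth_on_UNIV_flat smooth_on_UNIV_poly s)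
    show "((\<lambda>t. \<theta> t * poly (P n) t) has_real_derivative \<theta>' t * poly (P n) t + \<theta> t * poly (pderiv (P n)) t) (at t)" for t
      by (rule DERIV_cong[OF DERIV_mult[OF d\<theta> poly_DERIV]]) simp
    show "continuous_on UNIV (\<lambda>t. \<theta>' t * poly (P n) t + \<theta> t * poly (pderiv (P n)) t)"
      by (intro continuous_intros \<theta>c \<theta>'c)
    show "\<theta> (r\<^sup>2) * poly (P n) (r\<^sup>2) = 0 \<and> \<theta>' (r\<^sup>2) * poly (P n) (r\<^sup>2) + \<theta> (r\<^sup>2) * poly (pderiv (P n)) (r\<^sup>2) = 0"
      if "0 \<le> r" "r \<notin> {a'..b'}" for r
    proof -
      have "r\<^sup>2 \<notin> {A<..<B}" using that ab' unfolding A_def B_def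
        by (auto simp: not_le not_less intro: power_mono less_imp_le)
      then show ?thesis using \<theta>0 by simp
    qed
  qed (use n ab' in \<open>auto simp: E_def\<close>)
qed

text \<open>The smoothed test function is radial and lives in an annulus where the weights are
  continuous. Polar coordinates turn both sides into the same positive factor times one-dimensional
  integrals; these are finite, so the inequality in [0, \<infinity>] becomes one between reals and
  contradicts the negative energy.\<close>

lemma not_hardy_inequality:
  fixes V W \<phi> \<phi>' :: "real \<Rightarrow> real" and \<Omega> :: "'a::euclidean_space set"
  assumes ab: "0 < a" "a < b" "b < \<rho>" and \<Omega>: "ball 0 \<rho> \<subseteq> \<Omega>"
    and Vc: "continuous_on {0<..<\<rho>} V" and Wc: "continuous_on {0<..<\<rho>} W"
    and V: "\<And>r. r \<in> {0<..<\<rho>} \<Longrightarrow> V r > 0" and W: "\<And>r. r \<in> {0<..<\<rho>} \<Longrightarrow> W r > 0"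
    and d\<phi>: "\<And>r. r \<in> {0<..<\<rho>} \<Longrightarrow> (\<phi> has_real_derivative \<phi>' r) (at r)"
    and \<phi>'c: "continuous_on {0<..<\<rho>} \<phi>'"
    and zero: "\<And>r. r \<in> {0<..<\<rho>} - {a<..<b} \<Longrightarrow> \<phi> r = 0 \<and> \<phi>' r = 0"
    and neg: "integral {a..b} (\<lambda>r. r ^ (DIM('a) - 1) * V r * (\<phi>' r)\<^sup>2 - r ^ (DIM('a) - 1) * W r * (\<phi> r)\<^sup>2) < 0"
  shows "\<not> hardy_inequality V W \<Omega>"
proof
  assume hardy: "hardy_inequality V W \<Omega>"
  let ?m = "DIM('a) - 1"
  have pc: "continuous_on {0<..<\<rho>} (\<lambda>r. r ^ ?m * V r)" "continuous_on {0<..<\<rho>} (\<lambda>r. r ^ ?m * W r)"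
    by (intro continuous_intros Vc Wc)+
  obtain a' b' g g' where ab': "0 < a'" "a' < b'" "b' < \<rho>"
    and smooth: "smooth_on (\<lambda>x::'a. g (x \<bullet> x)) UNIV"
    and dg: "\<And>t. (g has_real_derivative g' t) (at t)" and g'c: "continuous_on UNIV g'"
    and out: "\<And>r. 0 \<le> r \<Longrightarrow> r \<notin> {a'..b'} \<Longrightarrow> g (r\<^sup>2) = 0 \<and> g' (r\<^sup>2) = 0"
    and neg': "integral {a'..b'} (\<lambda>r. r ^ ?m * V r * (2 * r * g' (r\<^sup>2))\<^sup>2 - r ^ ?m * W r * (g (r\<^sup>2))\<^sup>2) < 0"
    by (rule negative_smooth_energy[OF ab pc d\<phi> \<phi>'c zero neg]) auto
  define u where "u x = g (x \<bullet> x)" for x :: 'a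
  have xx: "x \<bullet> x = (norm x)\<^sup>2" for x :: 'a by (simp add: power2_norm_eq_inner)
  have supp: "closure {x. u x \<noteq> 0} \<subseteq> cball 0 b'"
  proof (rule closure_minimal)
    show "{x. u x \<noteq> 0} \<subseteq> cball 0 b'"
    proof
      fix x assume "x \<in> {x. u x \<noteq> 0}"
      then show "x \<in> cball 0 b'" using out[of "norm x"] by (force simp: u_def xx)
    qed
  qed simp
  have bR: "cball 0 b' \<subseteq> \<Omega>" using \<Omega> ab' by force
  have "compact (closure {x. u x \<noteq> 0})"
    using supp by (meson bounded_cball bounded_subset closed_closure compact_eq_bounded_closed)
  then have "u \<in> test_functions \<Omega>"
    using smooth supp bR by (auto simp: test_functions_def u_def[abs_def])
  then have le: "(\<integral>\<^sup>+x\<in>\<Omega>. ennreal (W (norm x) * (u x)\<^sup>2) \<partial>lborel)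
      \<le> (\<integral>\<^sup>+x\<in>\<Omega>. ennreal (V (norm x) * (norm (gradient u x))\<^sup>2) \<partial>lborel)"
    using hardy by (simp add: hardy_inequality_def)
  define f1 f2 where "f1 r = V r * (2 * r * g' (r\<^sup>2))\<^sup>2" and "f2 r = W r * (g (r\<^sup>2))\<^sup>2" for r
  have grad: "norm (gradient u x) = \<bar>2 * norm x * g' ((norm x)\<^sup>2)\<bar>" for x
    using gradient_power2_norm[OF dg, of x] unfolding u_def[abs_def] by (simp add: xx abs_mult)
  have in\<Omega>: "x \<in> \<Omega>" if "norm x \<in> {a'..b'}" for x using that bR by auto
  have gc: "continuous_on UNIV g" by (meson dg DERIV_isCont continuous_at_imp_continuous_on)
  have sub: "{a'..b'} \<subseteq> {0<..<\<rho>}" using ab' by auto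
  have gr: "continuous_on {a'..b'} (\<lambda>r. g (r\<^sup>2))" "continuous_on {a'..b'} (\<lambda>r. g' (r\<^sup>2))"
    by (rule continuous_on_compose2[OF gc] continuous_on_compose2[OF g'c]; auto intro!: continuous_intros)+
  have fc: "continuous_on {a'..b'} f1" "continuous_on {a'..b'} f2"
    unfolding f1_def f2_def
    by (intro continuous_intros continuous_on_subset[OF Vc sub] continuous_on_subset[OF Wc sub] gr)+
  have fnn: "f1 r \<ge> 0" "f2 r \<ge> 0" if "r \<in> {a'..b'}" for r
    using V[of r] W[of r] subsetD[OF sub that] by (auto simp: f1_def f2_def)
  define c where "c = real DIM('a) * unit_ball_vol DIM('a)"
  have c: "c > 0" by (simp add: c_def)
  \<comment> \<open>Off the annulus the gradient is 0. This includes the origin, where the value of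
    V is arbitrary.\<close>
  have 1: "(\<integral>\<^sup>+x\<in>\<Omega>. ennreal (V (norm x) * (norm (gradient u x))\<^sup>2) \<partial>lborel)
    = ennreal (c * integral {a'..b'} (\<lambda>r. r ^ ?m * f1 r))" (is "?lhs = ?rhs")
  proof -
    have "?lhs = (\<integral>\<^sup>+x. ennreal (f1 (norm x)) * indicator {a'..b'} (norm x) \<partial>(lborel :: 'a measure))"
      using in\<Omega> out by (intro nn_integral_cong) (auto simp: f1_def grad split: split_indicator)
    also have "\<dots> = ?rhs"
      unfolding c_def by (rule nn_integral_radial_annulus) (use ab' fc fnn in auto)
    finally show ?thesis .
  qed
  have 2: "(\<integral>\<^sup>+x\<in>\<Omega>. ennreal (W (norm x) * (u x)\<^sup>2) \<partial>lborel)
    = ennreal (c * integral {a'..b'} (\<lambda>r. r ^ ?m * f2 r))" (is "?lhs = ?rhs")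
  proof -
    have "?lhs = (\<integral>\<^sup>+x. ennreal (f2 (norm x)) * indicator {a'..b'} (norm x) \<partial>(lborel :: 'a measure))"
      using in\<Omega> out by (intro nn_integral_cong) (auto simp: f2_def u_def xx split: split_indicator)
    also have "\<dots> = ?rhs"
      unfolding c_def by (rule nn_integral_radial_annulus) (use ab' fc fnn in auto)
    finally show ?thesis .
  qed
  have i: "(\<lambda>r. r ^ ?m * f1 r) integrable_on {a'..b'}" "(\<lambda>r. r ^ ?m * f2 r) integrable_on {a'..b'}"
    by (intro integrable_continuous_real continuous_intros fc)+
  have "0 \<le> integral {a'..b'} (\<lambda>r. r ^ ?m * f1 r)"
    using i(1) by (rule integral_nonneg) (use fnn ab' in auto)
  then have "integral {a'..b'} (\<lambda>r. r ^ ?m * f2 r) \<le> integral {a'..b'} (\<lambda>r. r ^ ?m * f1 r)"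
    using le c unfolding 1 2 by (subst (asm) ennreal_le_iff) auto
  moreover have "integral {a'..b'} (\<lambda>r. r ^ ?m * f1 r) - integral {a'..b'} (\<lambda>r. r ^ ?m * f2 r) < 0"
    unfolding integral_diff[OF i, symmetric] using neg' by (simp only: f1_def f2_def mult.assoc)
  ultimately show False by simp
qed

section \<open>Validity of the Hardy inequality\<close>

lemma integral_lborel_scale:
  fixes f :: "'a::euclidean_space \<Rightarrow> real"
  assumes f: "integrable lborel f" and t: "t > 0"
  shows "integrable lborel (\<lambda>x. t ^ DIM('a) * f (t *\<^sub>R x))"
    and "(\<integral>x. t ^ DIM('a) * f (t *\<^sub>R x) \<partial>lborel) = (\<integral>x. f x \<partial>lborel)"
proof -
  have eq: "(lborel :: 'a measure) = density (distr lborel borel (\<lambda>x. t *\<^sub>R x)) (\<lambda>_. ennreal (t ^ DIM('a)))"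
    using lborel_affine[of t "0::'a"] t by simp
  have m: "f \<in> borel_measurable borel" using f by auto
  have "integrable (density (distr lborel borel (\<lambda>x::'a. t *\<^sub>R x)) (\<lambda>_. ennreal (t ^ DIM('a)))) f"
    using f eq by simp
  then have "integrable (distr lborel borel (\<lambda>x::'a. t *\<^sub>R x)) (\<lambda>x. t ^ DIM('a) * f x)"
    using m t by (subst (asm) integrable_density) auto
  then show "integrable lborel (\<lambda>x. t ^ DIM('a) * f (t *\<^sub>R x))"
    using m by (subst (asm) integrable_distr_eq) auto
  have "(\<integral>x. f x \<partial>lborel) = (\<integral>x. f x \<partial>density (distr lborel borel (\<lambda>x::'a. t *\<^sub>R x)) (\<lambda>_. ennreal (t ^ DIM('a))))"
    by (rule arg_cong[OF eq])
  also have "\<dots> = (\<integral>x. t ^ DIM('a) * f x \<partial>distr lborel borel (\<lambda>x::'a. t *\<^sub>R x))"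
    using m t by (subst integral_density) auto
  also have "\<dots> = (\<integral>x. t ^ DIM('a) * f (t *\<^sub>R x) \<partial>lborel)"
    using m by (subst integral_distr) auto
  finally show "(\<integral>x. t ^ DIM('a) * f (t *\<^sub>R x) \<partial>lborel) = (\<integral>x. f x \<partial>lborel)" ..
qed

lemma integrable_lborel_compact_support:
  fixes f :: "'a::euclidean_space \<Rightarrow> real"
  assumes "continuous_on UNIV f" "\<And>x. norm x > M \<Longrightarrow> f x = 0"
  shows "integrable lborel f"
proof -
  have "integrable lborel (\<lambda>x. indicator (cball 0 M) x *\<^sub>R f x)"
    by (intro borel_integrable_compact continuous_on_subset[OF assms(1)]) auto
  also have "(\<lambda>x. indicator (cball 0 M) x *\<^sub>R f x) = f"
    using assms(2) by (auto simp: fun_eq_iff indicator_def)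
  finally show ?thesis .
qed

text \<open>This is the divergence theorem for the field \<open>\<zeta>(x) x\<close>: differentiate the
  constant function \<open>t \<mapsto> \<integral> t\<^sup>n \<zeta>(t x) dx\<close> at \<open>t = 1\<close>.\<close>

lemma integral_divergence_radial_field:
  fixes \<zeta> :: "'a::euclidean_space \<Rightarrow> real"
  assumes \<zeta>: "\<And>x. (\<zeta> has_derivative \<zeta>' x) (at x)"
    and D: "\<And>x. D x = \<zeta>' x x + real DIM('a) * \<zeta> x" "continuous_on UNIV D"
    and supp: "\<And>x. norm x > M \<Longrightarrow> \<zeta> x = 0 \<and> D x = 0"
  shows "integrable lborel D" "(\<integral>x. D x \<partial>lborel) = 0"
proof -
  let ?n = "DIM('a)"
  show iD: "integrable lborel D" using D(2) supp by (intro integrable_lborel_compact_support) auto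
  have "continuous_on UNIV \<zeta>"
    using \<zeta> by (meson continuous_at_imp_continuous_on has_derivative_continuous)
  then have i\<zeta>: "integrable lborel \<zeta>" using supp by (intro integrable_lborel_compact_support) auto
  obtain B where B: "\<And>x. \<bar>D x\<bar> \<le> B" "B \<ge> 0"
  proof -
    have "bounded (D ` cball 0 M)"
      by (intro compact_imp_bounded compact_continuous_image continuous_on_subset[OF D(2)]) auto
    then obtain B where "\<And>x. x \<in> cball 0 M \<Longrightarrow> \<bar>D x\<bar> \<le> B" by (force simp: bounded_iff)
    then have "\<bar>D x\<bar> \<le> max B 0" for x using supp[of x] by (cases "norm x \<le> M") force+
    then show ?thesis using that by force
  qed
  \<comment> \<open>Only dilations by factors 1 + h with h > 0 are used: they move points outward,
    so a point outside the ball of radius M stays outside and every quotient \<open>s k\<close> is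
    supported in that ball.\<close>
  define h where "h k = inverse (real (Suc k))" for k
  have h: "h k > 0" "h k \<le> 1" for k by (simp_all add: h_def inverse_le_1_iff)
  define s where "s k x = ((1 + h k) ^ ?n * \<zeta> ((1 + h k) *\<^sub>R x) - \<zeta> x) / h k" for k x
  have n: "?n > 0" by simp
  \<comment> \<open>Up to the power of t, differentiating the dilated function gives D at the
    dilated point. At t = 1 this is the pointwise limit of the quotients; for t in [1, 2] it bounds
    them.\<close>
  have dg: "((\<lambda>t. t ^ ?n * \<zeta> (t *\<^sub>R x)) has_real_derivative t ^ (?n - 1) * D (t *\<^sub>R x)) (at t)"
    if t: "t > 0" for t x
  proof -
    have "((\<lambda>t. t *\<^sub>R x) has_derivative (\<lambda>k. k *\<^sub>R x)) (at t)" by (auto intro!: derivative_eq_intros)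
    from has_derivative_compose[OF this \<zeta>]
    have "((\<lambda>t. \<zeta> (t *\<^sub>R x)) has_real_derivative \<zeta>' (t *\<^sub>R x) x) (at t)"
      unfolding has_field_derivative_def using linear_cmul[OF has_derivative_linear[OF \<zeta>]]
      by (simp add: mult_commute_abs)
    from DERIV_mult[OF DERIV_pow this]
    have "((\<lambda>t. t ^ ?n * \<zeta> (t *\<^sub>R x)) has_real_derivative real ?n * t ^ (?n - Suc 0) * \<zeta> (t *\<^sub>R x) + \<zeta>' (t *\<^sub>R x) x * t ^ ?n) (at t)" .
    moreover have "t ^ ?n = t ^ (?n - 1) * t" using n by (metis power_minus_mult)
    moreover have "\<zeta>' (t *\<^sub>R x) (t *\<^sub>R x) = t * \<zeta>' (t *\<^sub>R x) x"
      using linear_cmul[OF has_derivative_linear[OF \<zeta>]] by simp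
    ultimately show ?thesis by (simp add: D(1) algebra_simps)
  qed
  have lim: "(\<lambda>k. s k x) \<longlonglongrightarrow> D x" for x
  proof -
    have "((\<lambda>y. ((1 + y) ^ ?n * \<zeta> ((1 + y) *\<^sub>R x) - 1 ^ ?n * \<zeta> (1 *\<^sub>R x)) / y) \<longlongrightarrow> D x) (at 0)"
      using dg[of 1 x] by (simp add: DERIV_def)
    moreover have "filterlim h (at 0) sequentially"
      unfolding filterlim_at h_def[abs_def] using LIMSEQ_inverse_real_of_nat by (auto simp: h_def[symmetric])
    ultimately show ?thesis unfolding s_def using filterlim_compose by force
  qed
  have si: "integrable lborel (s k)" "(\<integral>x. s k x \<partial>lborel) = 0" for k
    using integral_lborel_scale[OF i\<zeta>, of "1 + h k"] h[of k] i\<zeta> unfolding s_def[abs_def] by auto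
  have bound: "norm (s k x) \<le> indicator (cball 0 M) x *\<^sub>R (2 ^ ?n * B)" for k x
  proof (cases "norm x \<le> M")
    case True
    let ?g = "\<lambda>t. t ^ ?n * \<zeta> (t *\<^sub>R x)"
    have "norm (?g (1 + h k) - ?g 1) \<le> (2 ^ ?n * B) * norm ((1 + h k) - 1)"
    proof (rule field_differentiable_bound[of "{1..2}"])
      fix t :: real assume t: "t \<in> {1..2}"
      show "(?g has_real_derivative t ^ (?n - 1) * D (t *\<^sub>R x)) (at t within {1..2})"
        using dg[of t x] t by (auto intro: has_field_derivative_at_within)
      have "t ^ (?n - 1) \<le> 2 ^ ?n"
        using t by (intro order_trans[OF power_mono[of t 2] power_increasing]) auto
      then show "norm (t ^ (?n - 1) * D (t *\<^sub>R x)) \<le> 2 ^ ?n * B"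
        unfolding norm_mult using B t by (intro mult_mono) auto
    qed (use h[of k] in auto)
    then show ?thesis using True h[of k] by (simp add: s_def abs_mult field_simps)
  next
    case False
    have "norm x \<le> norm ((1 + h k) *\<^sub>R x)" using h(1)[of k] mult_right_mono[of 1 "1 + h k" "norm x"] by simp
    then show ?thesis using supp[of x] supp[of "(1 + h k) *\<^sub>R x"] False by (simp add: s_def)
  qed
  have "(\<lambda>k. \<integral>x. s k x \<partial>lborel) \<longlonglongrightarrow> (\<integral>x. D x \<partial>lborel)"
  proof (rule integral_dominated_convergence[where w = "\<lambda>x. indicator (cball 0 M) x *\<^sub>R (2 ^ ?n * B)"])
    show "integrable lborel (\<lambda>x::'a. indicator (cball 0 M) x *\<^sub>R (2 ^ ?n * B))"
      by (intro borel_integrable_compact) auto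
  qed (use si iD lim bound in auto)
  then show "(\<integral>x. D x \<partial>lborel) = 0" unfolding si(2) by (rule LIMSEQ_unique[OF _ tendsto_const])
qed

text \<open>The vanishing factor \<open>c\<^sup>2 = (max 0 (1 - \<epsilon>/r))\<^sup>2\<close> cuts off the origin; as it increases in \<open>r\<close>
  and \<open>w \<ge> 0\<close>, the extra term of the divergence of \<open>c\<^sup>2 w u\<^sup>2 x / r\<^sup>n\<close> has the favourable sign.\<close>

lemma riccati_imp_truncated_hardy:
  fixes V W w :: "real \<Rightarrow> real" and u :: "'a::euclidean_space \<Rightarrow> real"
  defines "n \<equiv> DIM('a)"
  assumes Vc: "continuous_on {0<..<\<rho>} V" and Wc: "continuous_on {0<..<\<rho>} W"
    and V: "\<And>r. r \<in> {0<..<\<rho>} \<Longrightarrow> V r > 0"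
    and w0: "\<And>r. r \<in> {0<..<\<rho>} \<Longrightarrow> w r \<ge> 0"
    and dw: "\<And>r. r \<in> {0<..<\<rho>} \<Longrightarrow>
      (w has_real_derivative (w r)\<^sup>2 / (r ^ (n - 1) * V r) + r ^ (n - 1) * W r) (at r)"
    and du: "\<And>x. (u has_derivative (\<lambda>v. G x \<bullet> v)) (at x)" and Gc: "continuous_on UNIV G"
    and supp: "\<And>x. norm x > M \<Longrightarrow> u x = 0 \<and> G x = 0"
    and eM: "0 < \<epsilon>" "\<epsilon> < M" "M < \<rho>"
  defines "\<kappa> \<equiv> \<lambda>x::'a. (max 0 (1 - \<epsilon> / norm x))\<^sup>2 * indicator {\<epsilon>..M} (norm x)"
  shows "integrable lborel (\<lambda>x. \<kappa> x * (W (norm x) * (u x)\<^sup>2))"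
    and "integrable lborel (\<lambda>x. \<kappa> x * (V (norm x) * (norm (G x))\<^sup>2))"
    and "(\<integral>x. \<kappa> x * (W (norm x) * (u x)\<^sup>2) \<partial>lborel) \<le> (\<integral>x. \<kappa> x * (V (norm x) * (norm (G x))\<^sup>2) \<partial>lborel)"
proof -
  have n: "n \<ge> 1" by (simp add: n_def Suc_leI)
  define c where "c r = max 0 (1 - \<epsilon> / r)" for r
  define p where "p r = r ^ (n - 1) * V r" for r
  define w' where "w' r = (w r)\<^sup>2 / p r + r ^ (n - 1) * W r" for r
  have dw': "(w has_real_derivative w' r) (at r)" if "r \<in> {0<..<\<rho>}" for r
    using dw[OF that] by (simp add: w'_def p_def)
  define \<gamma> where "\<gamma> r = (c r)\<^sup>2 * w r / r ^ n" for r
  \<comment> \<open>The divergence of \<gamma>(r) x is r \<gamma>' + n \<gamma>. The summand n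
    \<gamma> cancels the contribution of r^(-n), leaving r \<delta>, where \<delta> differentiates
    only the numerator of \<gamma>.\<close>
  define \<delta> where "\<delta> r = (2 * c r * (\<epsilon> / r\<^sup>2) * w r + (c r)\<^sup>2 * w' r) / r ^ n" for r
  define \<gamma>' where "\<gamma>' r = \<delta> r - real n * \<gamma> r / r" for r
  define \<zeta> where "\<zeta> x = \<gamma> (norm x) * (u x)\<^sup>2" for x
  define \<zeta>' where "\<zeta>' x v = (if norm x \<in> {0<..<\<rho>} then
     \<gamma>' (norm x) * (x \<bullet> v / norm x) * (u x)\<^sup>2 + \<gamma> (norm x) * (2 * u x * (G x \<bullet> v)) else 0)" for x v
  define D where "D x = \<delta> (norm x) * norm x * (u x)\<^sup>2 + \<gamma> (norm x) * (2 * u x * (G x \<bullet> x))" for x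
  have uc: "continuous_on UNIV u"
    using du by (meson continuous_at_imp_continuous_on has_derivative_continuous)
  have wc: "continuous_on {0<..<\<rho>} w"
    using dw' by (meson DERIV_isCont continuous_at_imp_continuous_on)
  have c0: "c r = 0" if "0 < r" "r \<le> \<epsilon>" for r using that by (simp add: c_def field_simps)
  \<comment> \<open>At r = 0 the cut-off \<open>c 0\<close> evaluates to 1; it is the division by
    \<open>0 ^ n\<close> with n \<ge> 1 that yields 0.\<close>
  have small: "\<gamma> r = 0 \<and> \<delta> r = 0" if "0 \<le> r" "r \<le> \<epsilon>" for r
    using that c0[of r] n by (cases "r = 0") (auto simp: \<gamma>_def \<delta>_def power_0_left)
  have d\<gamma>: "(\<gamma> has_real_derivative \<gamma>' r) (at r)" if r: "r \<in> {0<..<\<rho>}" for r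
  proof -
    have "((\<lambda>r. 1 - \<epsilon> / r) has_real_derivative \<epsilon> / r\<^sup>2) (at r)"
      using r by (auto intro!: derivative_eq_intros simp: power2_eq_square)
    then have 1: "((\<lambda>r. (c r)\<^sup>2) has_real_derivative 2 * c r * (\<epsilon> / r\<^sup>2)) (at r)"
      unfolding c_def[abs_def] by (rule DERIV_chain2[OF has_real_derivative_max_0_power2])
    have 2: "((\<lambda>r. r ^ n) has_real_derivative real n * r ^ (n - Suc 0)) (at r)" by (rule DERIV_pow)
    have r0: "r ^ n \<noteq> 0" "r \<noteq> 0" using r by auto
    have rn: "r ^ n = r * r ^ (n - Suc 0)" using n by (cases n) auto
    have "(\<gamma> has_real_derivative ((2 * c r * (\<epsilon> / r\<^sup>2) * w r + w' r * (c r)\<^sup>2) * r ^ n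
        - (c r)\<^sup>2 * w r * (real n * r ^ (n - Suc 0))) / (r ^ n * r ^ n)) (at r)"
      unfolding \<gamma>_def[abs_def] by (rule DERIV_divide[OF DERIV_mult[OF 1 dw'[OF r]] 2 r0(1)])
    also have "((2 * c r * (\<epsilon> / r\<^sup>2) * w r + w' r * (c r)\<^sup>2) * r ^ n
        - (c r)\<^sup>2 * w r * (real n * r ^ (n - Suc 0))) / (r ^ n * r ^ n) = \<gamma>' r"
      unfolding \<gamma>'_def \<delta>_def \<gamma>_def diff_divide_distrib using r0 by (simp add: rn mult_ac)
    finally show ?thesis .
  qed
  have open1: "open {x::'a. norm x < \<epsilon>}" "open {x::'a. M < norm x}"
    by (intro open_Collect_less continuous_intros)+
  have out: "\<zeta> x = 0 \<and> D x = 0" if "norm x < \<epsilon> \<or> M < norm x" for x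
    using that small[of "norm x"] supp[of x] by (auto simp: \<zeta>_def D_def)
  have out': "\<zeta>' x = (\<lambda>v. 0)" if "norm x < \<epsilon> \<or> M < norm x" for x
    using that small[of "norm x"] supp[of x] by (auto simp: \<zeta>'_def \<gamma>'_def fun_eq_iff)
  have d\<zeta>: "(\<zeta> has_derivative \<zeta>' x) (at x)" for x
  proof (cases "norm x < \<epsilon> \<or> M < norm x")
    case True
    have "((\<lambda>x::'a. 0::real) has_derivative (\<lambda>v. 0)) (at x)" by simp
    then have "(\<zeta> has_derivative (\<lambda>v. 0)) (at x)"
      by (rule has_derivative_transform_within_open[of _ _ _ _ "{x. norm x < \<epsilon>} \<union> {x. M < norm x}"])
        (use True out open1 in auto)
    then show ?thesis using out'[OF True] by simp
  next
    case False
    then have r: "norm x \<in> {0<..<\<rho>}" and x0: "x \<noteq> 0" using eM by auto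
    have 1: "((\<lambda>x. \<gamma> (norm x)) has_derivative (\<lambda>v. \<gamma>' (norm x) * (x \<bullet> v / norm x))) (at x)"
      using has_derivative_compose[OF has_derivative_norm[OF x0] d\<gamma>[OF r, unfolded has_field_derivative_def]]
      by (simp add: sgn_div_norm inner_commute divide_inverse mult_ac)
    have 2: "((\<lambda>x. (u x)\<^sup>2) has_derivative (\<lambda>v. 2 * u x * (G x \<bullet> v))) (at x)"
      using has_derivative_power[OF du, of 2 x] by (simp add: mult_ac)
    show ?thesis unfolding \<zeta>_def[abs_def]
      by (rule has_derivative_eq_rhs[OF has_derivative_mult[OF 1 2]]) (use r in \<open>auto simp: \<zeta>'_def fun_eq_iff\<close>)
  qed
  have D_eq: "D x = \<zeta>' x x + real DIM('a) * \<zeta> x" for x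
  proof (cases "norm x < \<epsilon> \<or> M < norm x")
    case True
    then show ?thesis using out[OF True] out'[OF True] by simp
  next
    case False
    then have r: "norm x \<in> {0<..<\<rho>}" using eM by auto
    have "x \<bullet> x / norm x = norm x" using r by (simp add: power2_norm_eq_inner[symmetric] power2_eq_square)
    then show ?thesis using r
      by (simp add: D_def \<zeta>'_def \<zeta>_def \<gamma>'_def n_def[symmetric]) (simp add: field_simps)
  qed
  have annulus: "open {x::'a. norm x \<in> {0<..<\<rho>}}"
  proof -
    have "open ({x::'a. 0 < norm x} \<inter> {x. norm x < \<rho>})"
      by (intro open_Int open_Collect_less continuous_intros)
    also have "{x::'a. 0 < norm x} \<inter> {x. norm x < \<rho>} = {x. norm x \<in> {0<..<\<rho>}}" by auto
    finally show ?thesis .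
  qed
  have comp: "continuous_on S (\<lambda>x::'a. f (norm x))"
    if "continuous_on {0<..<\<rho>} f" "\<And>x. x \<in> S \<Longrightarrow> norm x \<in> {0<..<\<rho>}" for f :: "real \<Rightarrow> real" and S
    by (rule continuous_on_compose2[OF that(1)]) (use that(2) in \<open>auto intro!: continuous_intros\<close>)
  have pne: "\<forall>r\<in>{0<..<\<rho>}. p r \<noteq> 0" "\<forall>r\<in>{0<..<\<rho>}. r ^ n \<noteq> 0" "\<forall>r\<in>{0<..<\<rho>}. r \<noteq> 0" "\<forall>r\<in>{0<..<\<rho>}. r\<^sup>2 \<noteq> 0"
    using less_imp_neq[OF V] by (auto simp: p_def)
  have cc: "continuous_on {0<..<\<rho>} c" unfolding c_def by (intro continuous_intros pne)
  have pc: "continuous_on {0<..<\<rho>} p" unfolding p_def by (intro continuous_intros Vc)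
  have w'c: "continuous_on {0<..<\<rho>} w'" unfolding w'_def by (intro continuous_intros pc wc Wc pne)
  have \<gamma>c: "continuous_on {0<..<\<rho>} \<gamma>" unfolding \<gamma>_def by (intro continuous_intros wc cc pne)
  have \<delta>c: "continuous_on {0<..<\<rho>} \<delta>" unfolding \<delta>_def by (intro continuous_intros wc cc w'c pne)
  have uS: "continuous_on S u" "continuous_on S G" for S
    using uc Gc continuous_on_subset by blast+
  have Dc: "continuous_on UNIV D"
  proof (rule continuous_at_imp_continuous_on, rule ballI)
    fix x :: 'a
    show "isCont D x"
    proof (cases "norm x < \<epsilon> \<or> M < norm x")
      case True
      have o: "open ({x::'a. norm x < \<epsilon>} \<union> {x. M < norm x})" using open1 by blast
      have "continuous_on ({x. norm x < \<epsilon>} \<union> {x. M < norm x}) D"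
        by (rule continuous_on_eq[of _ "\<lambda>_. 0"]) (use out in auto)
      then show ?thesis using True o by (simp add: continuous_on_eq_continuous_at)
    next
      case False
      have "continuous_on {x::'a. norm x \<in> {0<..<\<rho>}} D"
        unfolding D_def by (intro continuous_intros comp[OF \<delta>c] comp[OF \<gamma>c] uS) auto
      moreover have "norm x \<in> {0<..<\<rho>}" using False eM by auto
      ultimately show ?thesis using annulus by (simp add: continuous_on_eq_continuous_at)
    qed
  qed
  have D: "integrable lborel D" "(\<integral>x. D x \<partial>lborel) = 0"
    by (rule integral_divergence_radial_field[OF d\<zeta> D_eq Dc, of M]; use out in blast)+
  define S where "S = cball (0::'a) M - ball 0 \<epsilon>"
  have S: "x \<in> S \<longleftrightarrow> norm x \<in> {\<epsilon>..M}" for x by (auto simp: S_def)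
  have cS: "compact S" unfolding S_def by (intro compact_diff) auto
  have Sr: "norm x \<in> {0<..<\<rho>}" if "x \<in> S" for x using that eM by (auto simp: S)
  have \<kappa>: "\<kappa> x = (c (norm x))\<^sup>2 * indicator S x" for x
    by (simp add: \<kappa>_def c_def S indicator_def)
  have "integrable lborel (\<lambda>x. indicator S x *\<^sub>R ((c (norm x))\<^sup>2 * (W (norm x) * (u x)\<^sup>2)))"
    by (intro borel_integrable_compact cS continuous_intros comp[OF cc] comp[OF Wc] uS Sr)
  then show i1: "integrable lborel (\<lambda>x. \<kappa> x * (W (norm x) * (u x)\<^sup>2))"
    by (simp add: \<kappa> mult_ac)
  have "integrable lborel (\<lambda>x. indicator S x *\<^sub>R ((c (norm x))\<^sup>2 * (V (norm x) * (norm (G x))\<^sup>2)))"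
    by (intro borel_integrable_compact cS continuous_intros comp[OF cc] comp[OF Vc] uS Sr)
  then show i2: "integrable lborel (\<lambda>x. \<kappa> x * (V (norm x) * (norm (G x))\<^sup>2))"
    by (simp add: \<kappa> mult_ac)
  \<comment> \<open>With P = r^(n-1) and g = |G|, the square V (g - w |u| / (P V))^2 is nonnegative.
    Cauchy-Schwarz bounds u (G \<bullet> x) below by - |u| g r, and w \<ge> 0 keeps the direction of
    this bound.\<close>
  have le: "\<kappa> x * (W (norm x) * (u x)\<^sup>2) \<le> \<kappa> x * (V (norm x) * (norm (G x))\<^sup>2) + D x" for x
  proof (cases "x \<in> S")
    case False
    then show ?thesis using out[of x] by (auto simp: \<kappa> S not_le)
  next
    case True
    define r g where "r = norm x" and "g = norm (G x)"
    have r: "r \<in> {0<..<\<rho>}" using Sr[OF True] by (simp add: r_def)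
    define P where "P = r ^ (n - 1)"
    have P: "P > 0" using r by (simp add: P_def)
    have rn: "r ^ n = r * P" using n by (cases n) (auto simp: P_def)
    note Vr = V[OF r] and wr = w0[OF r]
    have \<delta>: "\<delta> r * r = 2 * c r * (\<epsilon> / r\<^sup>2) * w r / P + (c r)\<^sup>2 * ((w r)\<^sup>2 / (P\<^sup>2 * V r) + W r)"
      using r P Vr unfolding \<delta>_def w'_def p_def P_def[symmetric] rn
      by (simp add: field_simps power2_eq_square)
    have "c r \<ge> 0" by (simp add: c_def)
    then have nn: "0 \<le> 2 * c r * (\<epsilon> / r\<^sup>2) * w r / P" using eM wr P by simp
    have cs: "\<bar>u x * (G x \<bullet> x)\<bar> \<le> \<bar>u x\<bar> * (g * r)"
      unfolding abs_mult g_def r_def by (intro mult_left_mono Cauchy_Schwarz_ineq2) auto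
    have \<gamma>r: "\<gamma> r = (c r)\<^sup>2 * (w r / (r * P))" by (simp add: \<gamma>_def rn)
    have "0 \<le> (c r)\<^sup>2 * (V r * (g - w r * \<bar>u x\<bar> / (P * V r))\<^sup>2)" using Vr by simp
    also have "V r * (g - w r * \<bar>u x\<bar> / (P * V r))\<^sup>2
        = V r * g\<^sup>2 + (w r)\<^sup>2 / (P\<^sup>2 * V r) * (u x)\<^sup>2 - 2 * (w r / (r * P)) * (\<bar>u x\<bar> * (g * r))"
    proof -
      have "\<bar>u x\<bar> * \<bar>u x\<bar> = u x * u x" by simp
      then show ?thesis using r P Vr by (simp add: field_simps power2_eq_square)
    qed
    also have "(c r)\<^sup>2 * \<dots> \<le> (c r)\<^sup>2 * (V r * g\<^sup>2 + (w r)\<^sup>2 / (P\<^sup>2 * V r) * (u x)\<^sup>2 + 2 * (w r / (r * P)) * (u x * (G x \<bullet> x)))"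
    proof (rule mult_left_mono)
      have "(w r / (r * P)) * - (u x * (G x \<bullet> x)) \<le> (w r / (r * P)) * (\<bar>u x\<bar> * (g * r))"
        using cs wr r P by (intro mult_left_mono) auto
      then show "V r * g\<^sup>2 + (w r)\<^sup>2 / (P\<^sup>2 * V r) * (u x)\<^sup>2 - 2 * (w r / (r * P)) * (\<bar>u x\<bar> * (g * r))
        \<le> V r * g\<^sup>2 + (w r)\<^sup>2 / (P\<^sup>2 * V r) * (u x)\<^sup>2 + 2 * (w r / (r * P)) * (u x * (G x \<bullet> x))"
        by linarith
    qed simp
    finally have "0 \<le> (c r)\<^sup>2 * (V r * g\<^sup>2 + (w r)\<^sup>2 / (P\<^sup>2 * V r) * (u x)\<^sup>2 + 2 * (w r / (r * P)) * (u x * (G x \<bullet> x)))" .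
    also have "\<dots> = (c r)\<^sup>2 * (V r * g\<^sup>2) + (c r)\<^sup>2 * ((w r)\<^sup>2 / (P\<^sup>2 * V r)) * (u x)\<^sup>2 + \<gamma> r * (2 * u x * (G x \<bullet> x))"
      unfolding \<gamma>r by (simp add: algebra_simps)
    \<comment> \<open>The term with the derivative of the cut-off is nonnegative because the cut-off
      increases and w \<ge> 0.\<close>
    also have "\<dots> \<le> (c r)\<^sup>2 * (V r * g\<^sup>2) + (\<delta> r * r - (c r)\<^sup>2 * W r) * (u x)\<^sup>2 + \<gamma> r * (2 * u x * (G x \<bullet> x))"
      using mult_right_mono[OF nn, of "(u x)\<^sup>2"] unfolding \<delta> by (simp add: algebra_simps)
    finally show ?thesis using True by (simp add: \<kappa> D_def r_def g_def algebra_simps)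
  qed
  have "(\<integral>x. \<kappa> x * (W (norm x) * (u x)\<^sup>2) \<partial>lborel) \<le> (\<integral>x. \<kappa> x * (V (norm x) * (norm (G x))\<^sup>2) + D x \<partial>lborel)"
    by (intro integral_mono i1 Bochner_Integration.integrable_add i2 D le)
  also have "\<dots> = (\<integral>x. \<kappa> x * (V (norm x) * (norm (G x))\<^sup>2) \<partial>lborel)"
    by (simp add: Bochner_Integration.integral_add i2 D)
  finally show "(\<integral>x. \<kappa> x * (W (norm x) * (u x)\<^sup>2) \<partial>lborel) \<le> (\<integral>x. \<kappa> x * (V (norm x) * (norm (G x))\<^sup>2) \<partial>lborel)" .
qed

text \<open>The cut-off is removed by letting \<epsilon> tend to 0: Fatou's lemma serves the W side,
  while on the V side the truncated integrals are simply bounded by the full one, which may be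
  infinite.\<close>

lemma riccati_imp_hardy:
  fixes V W w :: "real \<Rightarrow> real"
  defines "n \<equiv> DIM('a::euclidean_space)"
  assumes rho: "\<rho> > 0"
    and Vc: "continuous_on {0<..<\<rho>} V" and Wc: "continuous_on {0<..<\<rho>} W"
    and V: "\<And>r. r \<in> {0<..<\<rho>} \<Longrightarrow> V r > 0" and W: "\<And>r. r \<in> {0<..<\<rho>} \<Longrightarrow> W r > 0"
    and w0: "\<And>r. r \<in> {0<..<\<rho>} \<Longrightarrow> w r \<ge> 0"
    and dw: "\<And>r. r \<in> {0<..<\<rho>} \<Longrightarrow>
      (w has_real_derivative (w r)\<^sup>2 / (r ^ (n - 1) * V r) + r ^ (n - 1) * W r) (at r)"
  shows "hardy_inequality V W (ball (0::'a) \<rho>)"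
  unfolding hardy_inequality_def
proof
  fix u :: "'a \<Rightarrow> real" assume u: "u \<in> test_functions (ball 0 \<rho>)"
  let ?K = "closure {x. u x \<noteq> 0}"
  have K: "compact ?K" "?K \<subseteq> ball 0 \<rho>" and smooth: "smooth_on u UNIV"
    using u by (auto simp: test_functions_def)
  obtain M where M: "0 < M" "M < \<rho>" "\<And>x. x \<in> ?K \<Longrightarrow> norm x \<le> M"
  proof (cases "?K = {}")
    case True
    then show ?thesis using that[of "\<rho> / 2"] rho by auto
  next
    case False
    have "\<exists>x\<in>?K. \<forall>y\<in>?K. norm y \<le> norm x"
      by (rule continuous_attains_sup[OF K(1) False]) (intro continuous_intros)
    then obtain x where "x \<in> ?K" "\<And>y. y \<in> ?K \<Longrightarrow> norm y \<le> norm x" by blast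
    moreover from this have "norm x < \<rho>" using K(2) by auto
    ultimately show ?thesis using rho by (intro that[of "max (norm x) (\<rho> / 2)"]) (auto simp: le_max_iff_disj)
  qed
  define G where "G = gradient u"
  have "Ck_on 1 u UNIV" using smooth by (simp add: smooth_on_def)
  then have diff: "(u has_derivative frechet_derivative u (at x)) (at x)"
    and cont: "continuous_on UNIV (\<lambda>x. frechet_derivative u (at x) v)" for x v
    by (auto simp: frechet_derivative_works)
  have Gv: "frechet_derivative u (at x) v = G x \<bullet> v" for x v
  proof -
    have "frechet_derivative u (at x) v = frechet_derivative u (at x) (\<Sum>b\<in>Basis. (v \<bullet> b) *\<^sub>R b)"
      by (simp only: euclidean_representation)
    also have "\<dots> = (\<Sum>b\<in>Basis. (v \<bullet> b) * frechet_derivative u (at x) b)"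
      using has_derivative_linear[OF diff] by (simp add: linear_sum linear_cmul)
    also have "\<dots> = G x \<bullet> v"
      by (simp add: G_def gradient_def inner_sum_left inner_commute[of v] mult_ac)
    finally show ?thesis .
  qed
  have du: "(u has_derivative (\<lambda>v. G x \<bullet> v)) (at x)" for x
    using diff[of x] by (simp add: Gv[symmetric])
  have Gc: "continuous_on UNIV G"
    unfolding G_def gradient_def by (intro continuous_intros cont)
  have supp: "u x = 0 \<and> G x = 0" if x: "norm x > M" for x
  proof -
    have "x \<in> - ?K" using M(3)[of x] x by (metis ComplI not_le)
    have z: "u y = 0" if "y \<in> - ?K" for y using that closure_subset[of "{x. u x \<noteq> 0}"] by blast
    have "((\<lambda>x. 0::real) has_derivative (\<lambda>v. 0)) (at x)" by simp
    then have "(u has_derivative (\<lambda>v. 0)) (at x)"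
      by (rule has_derivative_transform_within_open[of _ _ _ _ "- ?K"])
        (rule open_Compl, rule closed_closure, rule \<open>x \<in> - ?K\<close>, rule z[symmetric])
    then have "frechet_derivative u (at x) = (\<lambda>v. 0)" by (rule frechet_derivative_eqI)
    then have "G x = 0" by (simp add: G_def gradient_def)
    then show ?thesis using z[OF \<open>x \<in> - ?K\<close>] by blast
  qed
  let ?R = "\<integral>\<^sup>+x\<in>ball 0 \<rho>. ennreal (V (norm x) * (norm (gradient u x))\<^sup>2) \<partial>lborel"
  \<comment> \<open>The shift by two makes the first term M/2, so that \<epsilon> k < M holds from k
    = 0 on.\<close>
  define \<epsilon> where "\<epsilon> k = M * inverse (real (Suc (Suc k)))" for k
  have e: "0 < \<epsilon> k" "\<epsilon> k < M" for k
  proof -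
    have "inverse (real (Suc (Suc k))) < 1" by (simp add: inverse_less_1_iff)
    then show "0 < \<epsilon> k" "\<epsilon> k < M"
      using M(1) mult_strict_left_mono[of "inverse (real (Suc (Suc k)))" 1 M] by (simp_all add: \<epsilon>_def)
  qed
  have elim: "\<epsilon> \<longlonglongrightarrow> 0"
    using tendsto_mult[OF tendsto_const[of M] LIMSEQ_Suc[OF LIMSEQ_inverse_real_of_nat]]
    by (simp add: \<epsilon>_def[abs_def])
  \<comment> \<open>The indicator also removes the origin, where
    \<open>1 - \<epsilon> k / norm x\<close> evaluates to 1.\<close>
  define \<kappa> where "\<kappa> k x = (max 0 (1 - \<epsilon> k / norm x))\<^sup>2 * indicator {\<epsilon> k..M} (norm x)" for k and x :: 'a
  define b where "b k x = \<kappa> k x * (W (norm x) * (u x)\<^sup>2)" for k x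
  define a where "a k x = \<kappa> k x * (V (norm x) * (norm (G x))\<^sup>2)" for k x
  have \<kappa>: "0 \<le> \<kappa> k x" "\<kappa> k x \<le> 1" "\<kappa> k x = 0 \<or> norm x \<in> {0<..<\<rho>}" for k x
  proof -
    show "0 \<le> \<kappa> k x" by (simp add: \<kappa>_def)
    have "(max 0 (1 - \<epsilon> k / norm x))\<^sup>2 \<le> 1"
      using e[of k] by (intro power_le_one) auto
    then show "\<kappa> k x \<le> 1" by (simp add: \<kappa>_def indicator_def)
    show "\<kappa> k x = 0 \<or> norm x \<in> {0<..<\<rho>}"
      using e[of k] M(2) by (cases "norm x \<in> {\<epsilon> k..M}") (auto simp: \<kappa>_def)
  qed
  have bk: "(\<integral>\<^sup>+x. ennreal (b k x) \<partial>lborel) \<le> ?R" for k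
  proof -
    note T = riccati_imp_truncated_hardy[where 'a='a, folded n_def, OF Vc Wc V w0 dw du Gc supp e(1)[of k] e(2)[of k] M(2),
        folded \<kappa>_def[of k], folded a_def b_def]
    have ann: "0 \<le> a k x" "0 \<le> b k x" for x
      using \<kappa>(1)[of k x] \<kappa>(3)[of k x] V[of "norm x"] W[of "norm x"] by (auto simp: a_def b_def)
    have "(\<integral>\<^sup>+x. ennreal (b k x) \<partial>lborel) = ennreal (\<integral>x. b k x \<partial>lborel)"
      using T(1) ann by (intro nn_integral_eq_integral) auto
    also have "\<dots> \<le> ennreal (\<integral>x. a k x \<partial>lborel)" using T(3) by (rule ennreal_leI)
    also have "\<dots> = (\<integral>\<^sup>+x. ennreal (a k x) \<partial>lborel)"
      using T(2) ann by (intro nn_integral_eq_integral[symmetric]) auto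
    also have "\<dots> \<le> ?R"
    proof (rule nn_integral_mono)
      fix x :: 'a
      show "ennreal (a k x) \<le> ennreal (V (norm x) * (norm (gradient u x))\<^sup>2) * indicator (ball 0 \<rho>) x"
      proof (cases "norm x \<in> {0<..<\<rho>}")
        case True
        have "a k x \<le> V (norm x) * (norm (G x))\<^sup>2"
          unfolding a_def using \<kappa>(1,2)[of k x] V[OF True] by (intro mult_left_le_one_le) auto
        then show ?thesis using True by (simp add: G_def ennreal_leI)
      next
        case False
        then show ?thesis using \<kappa>(3)[of k x] by (auto simp: a_def)
      qed
    qed
    finally show ?thesis .
  qed
  \<comment> \<open>For x \<noteq> 0 the factor \<kappa> k x tends to 1 on the ball of radius M, and
    u vanishes beyond it. The exceptional point x = 0 is null.\<close>
  have "(\<integral>\<^sup>+x\<in>ball 0 \<rho>. ennreal (W (norm x) * (u x)\<^sup>2) \<partial>lborel) = (\<integral>\<^sup>+x. liminf (\<lambda>k. ennreal (b k x)) \<partial>lborel)"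
  proof (rule nn_integral_cong_AE, rule eventually_mono[OF AE_lborel_singleton[of 0]])
    fix x :: 'a assume x: "x \<noteq> 0"
    have "(\<lambda>k. b k x) \<longlonglongrightarrow> W (norm x) * (u x)\<^sup>2"
    proof (cases "norm x \<le> M")
      case False
      then show ?thesis using supp[of x] by (simp add: b_def)
    next
      case True
      have "\<forall>\<^sub>F k in sequentially. \<epsilon> k < norm x" using order_tendstoD(2)[OF elim] x by simp
      then have "\<forall>\<^sub>F k in sequentially. (max 0 (1 - \<epsilon> k / norm x))\<^sup>2 * (W (norm x) * (u x)\<^sup>2) = b k x"
        by eventually_elim (use True in \<open>simp add: b_def \<kappa>_def\<close>)
      moreover have "(\<lambda>k. (max 0 (1 - \<epsilon> k / norm x))\<^sup>2 * (W (norm x) * (u x)\<^sup>2)) \<longlonglongrightarrow> (max 0 (1 - 0 / norm x))\<^sup>2 * (W (norm x) * (u x)\<^sup>2)"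
        using x by (intro tendsto_intros elim) auto
      ultimately show ?thesis by (simp add: filterlim_cong[OF refl refl] Lim_transform_eventually)
    qed
    then have "liminf (\<lambda>k. ennreal (b k x)) = ennreal (W (norm x) * (u x)\<^sup>2)"
      by (intro lim_imp_Liminf) auto
    moreover have "u x = 0" if "x \<notin> ball 0 \<rho>" using that supp[of x] M(2) by auto
    ultimately show "ennreal (W (norm x) * (u x)\<^sup>2) * indicator (ball 0 \<rho>) x = liminf (\<lambda>k. ennreal (b k x))"
      by (auto simp: indicator_def)
  qed
  also have "\<dots> \<le> liminf (\<lambda>k. \<integral>\<^sup>+x. ennreal (b k x) \<partial>lborel)"
  proof (rule nn_integral_liminf)
    fix k
    have "integrable lborel (b k)"
      using riccati_imp_truncated_hardy(1)[where 'a='a, folded n_def, OF Vc Wc V w0 dw du Gc supp e(1)[of k] e(2)[of k] M(2),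
        folded \<kappa>_def[of k], folded b_def] .
    then show "(\<lambda>x. ennreal (b k x)) \<in> borel_measurable lborel" by measurable
  qed
  also have "\<dots> \<le> ?R" by (rule Liminf_le) (auto simp: bk)
  finally show "(\<integral>\<^sup>+x\<in>ball 0 \<rho>. ennreal (W (norm x) * (u x)\<^sup>2) \<partial>lborel) \<le> ?R" .
qed

section \<open>From the limits at the origin to bounds on a punctured neighbourhood\<close>

theorem theorem2p5:
  fixes V W :: "real \<Rightarrow> real" and R :: real
  defines "n \<equiv> CARD('n::finite)"
  assumes R: "R > 0"
    and V_pos: "\<And>r. 0 < r \<Longrightarrow> r < R \<Longrightarrow> V r > 0"
    and W_pos: "\<And>r. 0 < r \<Longrightarrow> r < R \<Longrightarrow> W r > 0"
    and V_C1: "Ck_on 1 (\<lambda>x::real^'n. V (norm x)) (ball 0 R - {0})"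
    and W_C1: "Ck_on 1 (\<lambda>x::real^'n. W (norm x)) (ball 0 R - {0})"
    and div: "tail_integral n V R 0 = \<infinity>"
    and fin: "(\<integral>\<^sup>+r\<in>{0<..<R}. ennreal (r ^ (n - 1) * V r) \<partial>lborel) < \<infinity>"
  shows "(Limsup (at_right 0) (kneser_quantity n V W R) < ennreal (1/4) \<longrightarrow>
            (\<exists>\<rho>. 0 < \<rho> \<and> \<rho> \<le> R \<and> has_positive_solution n V W \<rho> \<and>
                 hardy_inequality V W (ball (0::real^'n) \<rho>)))
       \<and> ((\<forall>r\<in>{0<..<R}. tail_integral n V R r < \<infinity>) \<longrightarrow>
            Liminf (at_right 0) (kneser_quantity n V W R) > ennreal (1/4) \<longrightarrow>
            (\<nexists>\<rho>. 0 < \<rho> \<and> \<rho> \<le> R \<and> has_positive_solution n V W \<rho>) \<and>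
            (\<nexists>\<Omega>::(real^'n) set. smooth_domain \<Omega> \<and> \<Omega> \<subseteq> ball 0 R \<and> 0 \<in> \<Omega> \<and>
                 hardy_inequality V W \<Omega>))"
proof -
  have n: "n \<ge> 1" "DIM(real^'n) = n" by (simp_all add: n_def Suc_leI)
  define p q where "p r = r ^ (n - 1) * V r" and "q r = r ^ (n - 1) * W r" for r
  define s where "s r = enn2real (tail_integral n V R r)" for r
  have dV: "(V has_real_derivative deriv V r) (at r)" if "r \<in> {0<..<R}" for r
    using C1_radial_profile(1)[OF V_C1 that] .
  have Vc: "continuous_on {0<..<R} V" and Wc: "continuous_on {0<..<R} W"
    using C1_radial_profile(1)[OF V_C1] C1_radial_profile(1)[OF W_C1]
    by (meson DERIV_isCont continuous_at_imp_continuous_on)+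
  have pc: "continuous_on {0<..<R} p" and qc: "continuous_on {0<..<R} q"
    unfolding p_def q_def by (intro continuous_intros Vc Wc)+
  have p: "p r > 0" and q: "q r > 0" if "r \<in> {0<..<R}" for r
    using that V_pos W_pos by (simp_all add: p_def q_def)
  have pq: "p r * q r = r ^ (2 * (n - 1)) * V r * W r" for r
    by (simp add: p_def q_def power_mult power2_eq_square power_mult_distrib mult_ac mult_2 power_add)
  have gc: "continuous_on {0<..<R} (\<lambda>r. 1 / p r)"
    using p by (intro continuous_intros pc) force
  have tail: "tail_integral n V R r = (\<integral>\<^sup>+\<tau>\<in>{r<..<R}. ennreal (1 / p \<tau>) \<partial>lborel)" for r
    by (simp add: tail_integral_def p_def)
  have props: "tail_integral n V R r = ennreal (s r)" "s r > 0" "(s has_real_derivative - 1 / p r) (at r)"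
    if tf: "\<And>r. r \<in> {0<..<R} \<Longrightarrow> tail_integral n V R r < \<infinity>" and r: "r \<in> {0<..<R}" for r
    using nn_integral_tail(1-3)[OF R gc _ tf[unfolded tail] div[unfolded tail] r] p
    unfolding s_def[abs_def] tail by auto
  have slim: "filterlim s at_top (at_right 0)" if tf: "\<And>r. r \<in> {0<..<R} \<Longrightarrow> tail_integral n V R r < \<infinity>"
    using nn_integral_tail(4)[OF R gc _ tf[unfolded tail] div[unfolded tail]] p
    unfolding s_def[abs_def] tail by auto
  have kneser: "kneser_quantity n V W R r = ennreal (p r * q r * (s r)\<^sup>2)"
    if tf: "\<And>r. r \<in> {0<..<R} \<Longrightarrow> tail_integral n V R r < \<infinity>" and r: "r \<in> {0<..<R}" for r
  proof -
    have "kneser_quantity n V W R r = ennreal (p r * q r) * (ennreal (s r))\<^sup>2"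
      by (simp only: kneser_quantity_def pq[symmetric] props(1)[OF tf r])
    also have "\<dots> = ennreal (p r * q r) * ennreal ((s r)\<^sup>2)"
      using props(2)[OF tf r] by (subst ennreal_power) auto
    also have "\<dots> = ennreal (p r * q r * (s r)\<^sup>2)"
      using p[OF r] q[OF r] by (intro ennreal_mult[symmetric]) auto
    finally show ?thesis .
  qed
  show ?thesis
  proof (intro conjI impI)
    assume lim: "Limsup (at_right 0) (kneser_quantity n V W R) < ennreal (1/4)"
    have "\<forall>\<^sub>F r in at_right 0. kneser_quantity n V W R r < ennreal (1/4)"
      using lim by (rule Limsup_lessD)
    then obtain d where d: "d > 0" "\<And>r. 0 < r \<Longrightarrow> r < d \<Longrightarrow> kneser_quantity n V W R r < ennreal (1/4)"
      by (auto simp: eventually_at_right_field)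
    define \<rho> where "\<rho> = min d R"
    have \<rho>: "0 < \<rho>" "\<rho> \<le> R" "\<rho> \<le> d" using d R by (auto simp: \<rho>_def)
    \<comment> \<open>Here finiteness is a consequence: an infinite tail at a small r' would
      multiply a positive coefficient and make the Kneser quantity infinite, against the bound near
      0. Tails starting further out are smaller.\<close>
    have tf: "tail_integral n V R r < \<infinity>" if r: "r \<in> {0<..<R}" for r
    proof -
      define r' where "r' = min r (\<rho> / 2)"
      have r': "r' \<in> {0<..<R}" "r' < d" "r' \<le> r" using r \<rho> by (auto simp: r'_def)
      have "tail_integral n V R r' < \<infinity>"
      proof (rule ccontr)
        assume "\<not> ?thesis"
        then have "tail_integral n V R r' = top" by (metis infinity_ennreal_def top.not_eq_extremum)
        then have "kneser_quantity n V W R r' = top"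
          using r'(1) V_pos[of r'] W_pos[of r'] by (simp add: kneser_quantity_def ennreal_mult_top)
        then show False using d(2)[of r'] r' by simp
      qed
      moreover have "tail_integral n V R r \<le> tail_integral n V R r'"
        unfolding tail_integral_def using r' by (intro nn_integral_mono) (auto split: split_indicator)
      ultimately show ?thesis by (rule le_less_trans[rotated])
    qed
    have sub: "{0<..<\<rho>} \<subseteq> {0<..<R}" using \<rho> by auto
    have bound: "p r * q r * (s r)\<^sup>2 \<le> 1/4" if r: "r \<in> {0<..<\<rho>}" for r
    proof -
      have "ennreal (p r * q r * (s r)\<^sup>2) < ennreal (1/4)"
        using d(2)[of r] r \<rho> kneser[OF tf, of r] by auto
      moreover have "0 \<le> p r * q r * (s r)\<^sup>2"
        using p[OF subsetD[OF sub r]] q[OF subsetD[OF sub r]] by simp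
      ultimately show ?thesis by (simp add: ennreal_less_iff)
    qed
    have pc': "continuous_on {0<..<\<rho>} p" and qc': "continuous_on {0<..<\<rho>} q"
      using continuous_on_subset[OF pc sub] continuous_on_subset[OF qc sub] by auto
    have pq': "p r > 0" "q r > 0" "s r > 0" "(s has_real_derivative - 1 / p r) (at r)"
      if "r \<in> {0<..<\<rho>}" for r
      using p q props(2,3)[OF tf] subsetD[OF sub that] by blast+
    have "\<exists>w. \<forall>r\<in>{0<..<\<rho>}. w r \<ge> 0 \<and> (w has_real_derivative (w r)\<^sup>2 / p r + q r) (at r)"
    proof (rule riccati_solution_exists[OF \<rho>(1) pc' qc' pq' slim[OF tf] bound])
      fix w
      assume "\<And>r. r \<in> {0<..<\<rho>} \<Longrightarrow> w r \<ge> 0"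
        "\<And>r. r \<in> {0<..<\<rho>} \<Longrightarrow> (w has_real_derivative (w r)\<^sup>2 / p r + q r) (at r)"
      then show ?thesis by (intro exI[of _ w] ballI conjI)
    qed
    then obtain w where w0: "\<And>r. r \<in> {0<..<\<rho>} \<Longrightarrow> w r \<ge> 0"
      and dw: "\<And>r. r \<in> {0<..<\<rho>} \<Longrightarrow> (w has_real_derivative (w r)\<^sup>2 / p r + q r) (at r)"
      by blast
    note dw' = dw[unfolded p_def q_def]
    have "has_positive_solution n V W \<rho>"
      by (rule riccati_imp_positive_solution[OF \<rho>(1) n(1) _ _ dw']) (use sub V_pos dV \<rho> in auto)
    moreover have "hardy_inequality V W (ball (0::real^'n) \<rho>)"
      by (rule riccati_imp_hardy[OF \<rho>(1) continuous_on_subset[OF Vc sub] continuous_on_subset[OF Wc sub] _ _ w0])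
        (use V_pos W_pos \<rho> dw' n in auto)
    ultimately show "\<exists>\<rho>. 0 < \<rho> \<and> \<rho> \<le> R \<and> has_positive_solution n V W \<rho> \<and> hardy_inequality V W (ball (0::real^'n) \<rho>)"
      using \<rho> by blast
  next
    assume tf': "\<forall>r\<in>{0<..<R}. tail_integral n V R r < \<infinity>"
      and lim: "Liminf (at_right 0) (kneser_quantity n V W R) > ennreal (1/4)"
    have tf: "tail_integral n V R r < \<infinity>" if "r \<in> {0<..<R}" for r using tf' that by blast
    \<comment> \<open>A number strictly between 1/4 and the lower limit yields the uniform gap c -
      1/4 > 0 on which the width of the bump depends.\<close>
    obtain C where C: "ennreal (1/4) < C" "C < Liminf (at_right 0) (kneser_quantity n V W R)"
      using lim dense by blast
    have "C < top" using C(2) by (rule less_le_trans) simp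
    define c where "c = enn2real C"
    have cC: "C = ennreal c" using \<open>C < top\<close> by (simp add: c_def)
    have c: "c > 1/4" using C(1) unfolding cC by (simp add: ennreal_less_iff)
    have "\<forall>\<^sub>F r in at_right 0. C < kneser_quantity n V W R r"
      using C(2) by (rule less_LiminfD)
    then obtain d where d: "d > 0" "\<And>r. 0 < r \<Longrightarrow> r < d \<Longrightarrow> C < kneser_quantity n V W R r"
      by (auto simp: eventually_at_right_field)
    \<comment> \<open>Stated for every small \<rho>, because the two claims need the bump inside
      different neighbourhoods: the interval of the solution and a ball contained in the
      domain.\<close>
    have test: "\<exists>a b \<phi> \<phi>'. 0 < a \<and> a < b \<and> b < \<rho> \<and> (\<forall>r\<in>{0<..<\<rho>}. (\<phi> has_real_derivative \<phi>' r) (at r)) \<and>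
        continuous_on {0<..<\<rho>} \<phi>' \<and> (\<forall>r\<in>{0<..<\<rho>} - {a<..<b}. \<phi> r = 0 \<and> \<phi>' r = 0) \<and>
        integral {a..b} (\<lambda>r. p r * (\<phi>' r)\<^sup>2 - q r * (\<phi> r)\<^sup>2) < 0"
      if \<rho>: "0 < \<rho>" "\<rho> \<le> R" "\<rho> \<le> d" for \<rho>
    proof -
      have sub: "{0<..<\<rho>} \<subseteq> {0<..<R}" using \<rho> by auto
      have bound: "c \<le> p r * q r * (s r)\<^sup>2" if r: "r \<in> {0<..<\<rho>}" for r
      proof -
        have "ennreal c < ennreal (p r * q r * (s r)\<^sup>2)"
          using d(2)[of r] r \<rho> kneser[OF tf, of r] by (auto simp: cC)
        then show ?thesis using c by (simp add: ennreal_less_iff)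
      qed
      have pc': "continuous_on {0<..<\<rho>} p" and qc': "continuous_on {0<..<\<rho>} q"
        using continuous_on_subset[OF pc sub] continuous_on_subset[OF qc sub] by auto
      have p': "p r > 0" "s r > 0" "(s has_real_derivative - 1 / p r) (at r)" if "r \<in> {0<..<\<rho>}" for r
        using p props(2,3)[OF tf] subsetD[OF sub that] by blast+
      show ?thesis
      proof (rule negative_energy[OF \<rho>(1) pc' qc' p' slim[OF tf] c bound])
        fix a b \<phi> \<phi>'
        assume "0 < a" "a < b" "b < \<rho>"
          "\<And>r. r \<in> {0<..<\<rho>} \<Longrightarrow> (\<phi> has_real_derivative \<phi>' r) (at r)"
          "continuous_on {0<..<\<rho>} \<phi>'"
          "\<And>r. r \<in> {0<..<\<rho>} - {a<..<b} \<Longrightarrow> \<phi> r = 0 \<and> \<phi>' r = 0"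
          "integral {a..b} (\<lambda>r. p r * (\<phi>' r)\<^sup>2 - q r * (\<phi> r)\<^sup>2) < 0"
        then show ?thesis
          by (intro exI[of _ a] exI[of _ b] exI[of _ \<phi>] exI[of _ \<phi>'] conjI ballI) blast+
      qed
    qed
    show "\<nexists>\<rho>. 0 < \<rho> \<and> \<rho> \<le> R \<and> has_positive_solution n V W \<rho>"
    proof
      assume "\<exists>\<rho>. 0 < \<rho> \<and> \<rho> \<le> R \<and> has_positive_solution n V W \<rho>"
      then obtain \<rho> where \<rho>: "0 < \<rho>" "\<rho> \<le> R" and sol: "has_positive_solution n V W \<rho>" by blast
      have sub: "{0<..<\<rho>} \<subseteq> {0<..<R}" using \<rho> by auto
      obtain w where w: "\<And>r. r \<in> {0<..<\<rho>} \<Longrightarrow> (w has_real_derivative (w r)\<^sup>2 / p r + q r) (at r)"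
        unfolding p_def q_def
        by (rule positive_solution_imp_riccati[OF n(1) _ _ sol]) (use V_pos dV \<rho> in auto)
      \<comment> \<open>The bump must lie both where the solution exists and where the lower bound
        by c holds.\<close>
      have md: "0 < min \<rho> d" "min \<rho> d \<le> R" "min \<rho> d \<le> d" using \<rho> d(1) by auto
      obtain a b \<phi> \<phi>' where ab: "0 < a" "a < b" "b < min \<rho> d"
        and \<phi>: "\<forall>r\<in>{0<..<min \<rho> d}. (\<phi> has_real_derivative \<phi>' r) (at r)" "continuous_on {0<..<min \<rho> d} \<phi>'"
        and zero: "\<forall>r\<in>{0<..<min \<rho> d} - {a<..<b}. \<phi> r = 0 \<and> \<phi>' r = 0"
        and neg: "integral {a..b} (\<lambda>r. p r * (\<phi>' r)\<^sup>2 - q r * (\<phi> r)\<^sup>2) < 0"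
        using test[OF md] by blast
      have ab_sub: "{a..b} \<subseteq> {0<..<min \<rho> d}" "{a..b} \<subseteq> {0<..<R}" using ab \<rho> by auto
      have "0 \<le> integral {a..b} (\<lambda>r. p r * (\<phi>' r)\<^sup>2 - q r * (\<phi> r)\<^sup>2)"
      proof (rule riccati_energy_nonneg[where w = w])
        show "\<phi> a = 0" "\<phi> b = 0" using zero ab by auto
        show "continuous_on {a..b} \<phi>'" using \<phi>(2) ab_sub(1) by (rule continuous_on_subset)
        show "continuous_on {a..b} p" using pc ab_sub(2) by (rule continuous_on_subset)
        show "continuous_on {a..b} q" using qc ab_sub(2) by (rule continuous_on_subset)
      qed (use ab ab_sub w p \<phi>(1) in auto)
      with neg show False by simp
    qed
    show "\<nexists>\<Omega>::(real^'n) set. smooth_domain \<Omega> \<and> \<Omega> \<subseteq> ball 0 R \<and> 0 \<in> \<Omega> \<and> hardy_inequality V W \<Omega>"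
    proof
      assume "\<exists>\<Omega>::(real^'n) set. smooth_domain \<Omega> \<and> \<Omega> \<subseteq> ball 0 R \<and> 0 \<in> \<Omega> \<and> hardy_inequality V W \<Omega>"
      then obtain \<Omega> :: "(real^'n) set" where \<Omega>: "open \<Omega>" "0 \<in> \<Omega>" and hardy: "hardy_inequality V W \<Omega>"
        by (auto simp: smooth_domain_def)
      \<comment> \<open>A small ball around 0 inside \<Omega> gives enough room, since negative
        energy occurs arbitrarily close to the origin.\<close>
      then obtain e where e: "e > 0" "ball 0 e \<subseteq> \<Omega>" using open_contains_ball by blast
      define \<rho> where "\<rho> = min e (min d R)"
      have \<rho>: "0 < \<rho>" "\<rho> \<le> R" "\<rho> \<le> d" "ball 0 \<rho> \<subseteq> \<Omega>" using e d(1) R by (auto simp: \<rho>_def)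
      have sub: "{0<..<\<rho>} \<subseteq> {0<..<R}" using \<rho> by auto
      obtain a b \<phi> \<phi>' where ab: "0 < a" "a < b" "b < \<rho>"
        and \<phi>: "\<forall>r\<in>{0<..<\<rho>}. (\<phi> has_real_derivative \<phi>' r) (at r)" "continuous_on {0<..<\<rho>} \<phi>'"
        and zero: "\<forall>r\<in>{0<..<\<rho>} - {a<..<b}. \<phi> r = 0 \<and> \<phi>' r = 0"
        and neg: "integral {a..b} (\<lambda>r. p r * (\<phi>' r)\<^sup>2 - q r * (\<phi> r)\<^sup>2) < 0"
        using test[OF \<rho>(1-3)] by blast
      have "\<not> hardy_inequality V W \<Omega>"
      proof (rule not_hardy_inequality[OF ab \<rho>(4) continuous_on_subset[OF Vc sub] continuous_on_subset[OF Wc sub] _ _ _ \<phi>(2)])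
        show "integral {a..b} (\<lambda>r. r ^ (DIM(real^'n) - 1) * V r * (\<phi>' r)\<^sup>2 - r ^ (DIM(real^'n) - 1) * W r * (\<phi> r)\<^sup>2) < 0"
          using neg by (simp only: n(2) p_def q_def)
      qed (use V_pos W_pos \<rho> \<phi>(1) zero in auto)
      with hardy show False by simp
    qed
  qed
qed

end
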